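(* Let $p$ be a prime, let $k,\ell$ be positive integers, and write $q:=p^k$ and $Q:=p^\ell$. Let $r$ be a positive integer such that $r\equiv Q+1\pmod{q+1}$. Let $a,b,c,d\in\mathbb{F}_{q^2}$ and write $A(X):=aX^{Q+1}+bX^Q+cX+d$. Then the polynomial $X^rA(X^{q-1})=aX^{r+qQ+q-Q-1}+bX^{r+qQ-Q}+cX^{r+q-1}+dX^r$ permutes $\mathbb{F}_{q^2}$ if and only if all of the following hold: (1) $\gcd(r,q-1)=1$; (2) $p=2$; (3) $e:=a^{q+1}+b^{q+1}+c^{q+1}+d^{q+1}$ is nonzero; (4) $(ab^q+cd^q)^Q=e^{Q-1}(ac^q+bd^q)$; (5) writing $m$ for the largest integer of the form $2^i$ (with $i\ge 0$) which divides $\gcd(k,\ell)$, we have $$\mathrm{Tr}_{\mathbb{F}_q/\mathbb{F}_{2^m}}\Bigl(\frac{b^{q+1}+c^{q+1}}{e}\Bigr)=\frac{\mathrm{lcm}(k,\ell)}{m}.$$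
   Context: A polynomial $f(X)\in\mathbb{F}_{q^2}[X]$ permutes $\mathbb{F}_{q^2}$ if $\alpha\mapsto f(\alpha)$ is a bijection of $\mathbb{F}_{q^2}$. When $p=2$, note that $e$ and $b^{q+1}+c^{q+1}$ lie in $\mathbb{F}_q$; $\mathrm{Tr}_{\mathbb{F}_q/\mathbb{F}_{2^m}}(X)=X+X^{2^m}+X^{2^{2m}}+\dots+X^{q/2^m}$ is the trace, and the integer $\mathrm{lcm}(k,\ell)/m$ in (5) is viewed as an element of $\mathbb{F}_2\subseteq\mathbb{F}_{2^m}$ (i.e. reduced mod $2$). *)

theory Defs
  imports
    "HOL-Computational_Algebra.Computational_Algebra"
    "HOL-Library.Cardinality"
    "HOL-Number_Theory.Cong"
begin

definition permutation_poly :: "'a::finite_field poly \<Rightarrow> bool" where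
  "permutation_poly f \<longleftrightarrow> bij (poly f)"

definition A_poly :: "nat \<Rightarrow> 'a::finite_field \<Rightarrow> 'a \<Rightarrow> 'a \<Rightarrow> 'a \<Rightarrow> 'a poly" where
  "A_poly Q a b c d = monom a (Q + 1) + monom b Q + monom c 1 + monom d 0"

(* x + x^s + x^(s^2) + ... + x^(s^(n-1)): the trace from the field with s ^ n elements to its
   subfield with s elements, evaluated by the same polynomial on any larger finite field 'a. *)
definition trace_map :: "nat \<Rightarrow> nat \<Rightarrow> 'a::finite_field \<Rightarrow> 'a" where
  "trace_map s n x = (\<Sum>i<n. x ^ (s ^ i))"

lemma monom_mult_pcompose_A_poly:
  fixes a b c d :: "'a::finite_field"
  assumes "q \<ge> 1" and "Q \<ge> 1"
  shows "monom 1 r * pcompose (A_poly Q a b c d) (monom 1 (q - 1)) =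
    monom a (r + q * Q + q - Q - 1) + monom b (r + q * Q - Q)
    + monom c (r + q - 1) + monom d r"
proof -
  have comp: "pcompose (monom u n) (monom 1 (q - 1)) = monom u ((q - 1) * n)"
    for u :: 'a and n
  proof -
    have "monom u n = smult u (monom 1 n)"
      by (simp add: smult_monom)
    moreover have "pcompose (monom 1 n) (monom 1 (q - 1)) = (monom (1::'a) (q - 1)) ^ n"
      by (induction n) (simp_all add: monom_Suc pcompose_pCons pcompose_1)
    ultimately show ?thesis
      by (metis monom_power mult.commute mult.right_neutral pcompose_smult power_one smult_monom)
  qed
  obtain q' where q: "q = Suc q'" using assms(1) by (cases q) auto
  have "r + (q - 1) * (Q + 1) = r + q * Q + q - Q - 1"
    and "r + (q - 1) * Q = r + q * Q - Q" and "r + (q - 1) = r + q - 1"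
    by (simp_all add: q)
  then show ?thesis
    unfolding A_poly_def pcompose_add comp by (simp add: distrib_left mult_monom)
qed

end

theory Submission
  imports Defs
begin

text \<open>
  Write \<open>z'\<close> for \<open>z ^ q\<close>. Up to nonzero factors from the subfield with \<open>q\<close> elements, the polynomial
  takes the values \<open>G(z) = B(z ^ Q, z)\<close>, where \<open>B(w, z) = a w' z' + b w' z + c w z' + d w z\<close>. So it
  is a permutation iff \<open>gcd(r, q - 1) = 1\<close> and \<open>G\<close> is injective on the lines over the subfield. The
  elements \<open>z\<close> for which \<open>B(-, z)\<close> is singular are the zeros of a binary quadratic form \<open>R\<close> over the
  subfield.

  If \<open>G\<close> is injective and \<open>R\<close> has a zero \<open>z\<close>, then uniqueness of preimages forces a basis \<open>z, w\<close>
  with \<open>G(x z + y w) = x ^ (Q + 1) G(z) + y ^ (Q + 1) G(w)\<close>. If \<open>R\<close> is anisotropic, its roots over the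
  big field allow a substitution \<open>z = u y + v y'\<close> and a change of target after which \<open>a = c = 0\<close>, and
  the first power sum over the unit circle \<open>x x' = 1\<close> yields \<open>b = 0\<close> or \<open>d = 0\<close>. In each
  case \<open>G\<close> is equivalent to a power with exponent \<open>Q + 1\<close> or \<open>Q + q\<close>, which can be injective only if
  \<open>p = 2\<close>. Conversely, (3) and (4) say that \<open>R\<close> and the corresponding form for the other argument of
  \<open>B\<close> have the same two distinct roots, which again makes \<open>B\<close> diagonal or antidiagonal in suitable
  coordinates. The trace in (5) depends only on the normal form, and (5) becomes the coprimality
  condition for the power map.
\<close>

declare One_nat_def [simp del]

subsection \<open>Roots of unity in finite fields\<close>

lemma card_roots_of_unity_le:
  assumes "n > 0"
  shows "card {x::'a::finite_field. x ^ n = 1} \<le> n"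
proof -
  have "degree (monom (1::'a) n - 1) \<le> n"
    by (intro degree_diff_le) (auto simp: degree_monom_le)
  moreover have "coeff (monom (1::'a) n - 1) n = 1"
    using assms by simp
  then have "monom (1::'a) n - 1 \<noteq> 0"
    by force
  ultimately show ?thesis
    using card_poly_roots_bound[of "monom (1::'a) n - 1"] by (simp add: poly_monom)
qed

lemma power_CARD_minus_1:
  fixes x :: "'a::finite_field"
  assumes "x \<noteq> 0"
  shows "x ^ (CARD('a) - 1) = 1"
proof -
  have "CARD('a) = Suc (CARD('a) - 1)"
    by (simp add: finite_UNIV_card_ge_0)
  then have "x * x ^ (CARD('a) - 1) = x * 1"
    using finite_field_power_card_eq_same[of x] by (metis mult.right_neutral power_Suc)
  then show ?thesis
    using assms by (metis mult_left_cancel)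
qed

text \<open>Counting replaces cyclicity of the unit group: fibres of the \<open>m\<close>-th power
  map have at most \<open>m\<close> elements, so its image has at least \<open>n\<close>; the image
  consists of \<open>n\<close>-th roots of unity, of which there are at most
  \<open>n\<close>.\<close>

lemma roots_of_unity_finite_field:
  assumes nm: "n * m = CARD('a::finite_field) - 1"
  shows "{x::'a. x ^ n = 1} = (\<lambda>x. x ^ m) ` (UNIV - {0})" and "card {x::'a. x ^ n = 1} = n"
proof -
  let ?R = "{x::'a. x ^ n = 1}" and ?I = "(\<lambda>x::'a. x ^ m) ` (UNIV - {0})"
  have "card {0::'a, 1} \<le> CARD('a)"
    by (intro card_mono) auto
  then have pos: "CARD('a) - 1 > 0"
    by simp
  then have "n > 0" "m > 0"
    using nm by (metis mult_0 mult_0_right neq0_conv)+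
  have sub: "?I \<subseteq> ?R"
    using nm by (auto simp: power_CARD_minus_1 mult.commute simp flip: power_mult)
  have "card (UNIV - {0::'a}) \<le> m * card ?I"
  proof -
    have "card (UNIV - {0::'a}) = card (\<Union>y\<in>?I. {x. x \<noteq> 0 \<and> x ^ m = y})"
      by (rule arg_cong[where f = card]) auto
    also have "\<dots> \<le> (\<Sum>y\<in>?I. card {x::'a. x \<noteq> 0 \<and> x ^ m = y})"
      by (intro card_UN_le) auto
    also have "\<dots> \<le> (\<Sum>y\<in>?I. m)"
    proof (intro sum_mono)
      fix y assume "y \<in> ?I"
      then obtain x0 :: 'a where x0: "x0 \<noteq> 0" "y = x0 ^ m"
        by auto
      then have "(\<lambda>x. x / x0) ` {x::'a. x \<noteq> 0 \<and> x ^ m = y} \<subseteq> {x. x ^ m = 1}"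
        by (auto simp: power_divide)
      moreover have "inj_on (\<lambda>x. x / x0) {x::'a. x \<noteq> 0 \<and> x ^ m = y}"
        using x0 by (auto simp: inj_on_def)
      ultimately show "card {x::'a. x \<noteq> 0 \<and> x ^ m = y} \<le> m"
        using card_roots_of_unity_le[OF \<open>m > 0\<close>, where ?'a = 'a]
        by (meson card_inj_on_le finite le_trans)
    qed
    finally show ?thesis
      by (simp add: mult.commute)
  qed
  then have "n * m \<le> m * card ?I"
    using nm by (simp add: card_Diff_subset)
  then have "n \<le> card ?I"
    using \<open>m > 0\<close> by (simp add: mult.commute)
  moreover have "card ?I \<le> card ?R"
    using sub by (intro card_mono) auto
  moreover have "card ?R \<le> n"
    using \<open>n > 0\<close> by (rule card_roots_of_unity_le)
  ultimately show "card ?R = n" "?R = ?I"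
    using card_subset_eq[OF _ sub] by auto
qed

text \<open>As \<open>gcd r n\<close> divides the order of the unit group, there are exactly
  \<open>gcd r n\<close> roots of unity of that exponent, and all of them satisfy both equations.
  The other direction is Bezout.\<close>

lemma power_inj_iff_coprime:
  assumes "n dvd CARD('a::finite_field) - 1"
  shows "(\<forall>x::'a. x ^ n = 1 \<longrightarrow> x ^ r = 1 \<longrightarrow> x = 1) \<longleftrightarrow> coprime r n"
proof
  assume R: "\<forall>x::'a. x ^ n = 1 \<longrightarrow> x ^ r = 1 \<longrightarrow> x = 1"
  have "gcd r n dvd CARD('a) - 1"
    using assms by (meson dvd_trans gcd_dvd2)
  then obtain m where "gcd r n * m = CARD('a) - 1"
    by (metis dvdE)
  then have "card {x::'a. x ^ gcd r n = 1} = gcd r n"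
    by (rule roots_of_unity_finite_field)
  moreover have "{x::'a. x ^ gcd r n = 1} = {1}"
  proof -
    have "x = 1" if "x ^ gcd r n = 1" for x :: 'a
      using that R by (metis dvdE gcd_dvd1 gcd_dvd2 power_mult power_one)
    then show ?thesis
      by auto
  qed
  ultimately show "coprime r n"
    by (simp add: coprime_iff_gcd_eq_1)
next
  assume co: "coprime r n"
  show "\<forall>x::'a. x ^ n = 1 \<longrightarrow> x ^ r = 1 \<longrightarrow> x = 1"
  proof (intro allI impI)
    fix x :: 'a
    assume x: "x ^ n = 1" "x ^ r = 1"
    show "x = 1"
    proof (cases "r = 0")
      case True
      then show ?thesis
        using co x by simp
    next
      case False
      then obtain u v where "r * u = n * v + gcd r n"
        using bezout_nat by blast
      then have "r * u = n * v + 1"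
        using co by (simp add: coprime_iff_gcd_eq_1)
      then have "x ^ (r * u) = x ^ (n * v) * x"
        by (simp add: power_add)
      then show ?thesis
        using x by (simp add: power_mult)
    qed
  qed
qed

text \<open>Modulo a common divisor, \<open>s ^ (K * L)\<close> can be computed from either number;
  comparison shows that the divisor divides 2, while \<open>s ^ K + 1\<close> is odd. In the failing
  cases \<open>s + 1\<close> is a common divisor.\<close>

lemma coprime_power_plus_1_iff:
  fixes s :: int
  assumes "even s" "s > 0" "K > 0" and parity: "odd K \<or> odd L"
  shows "coprime (s ^ L + 1) (s ^ K + 1) \<longleftrightarrow> even K \<or> even L"
    and "coprime (s ^ L - 1) (s ^ K + 1) \<longleftrightarrow> odd L"
proof -
  have s1: "\<not> is_unit (s + 1)"
    using assms by auto
  have neg: "[s = -1] (mod (s + 1))"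
    by (simp add: cong_iff_dvd_diff)
  have "odd (s ^ K + 1)"
    using assms by simp
  then have co2: "coprime 2 (s ^ K + 1)"
    by simp
  have unit: "is_unit g" if "g dvd s ^ K + 1" "g dvd 2" for g
    using that co2 coprime_common_divisor by blast
  have pows: "[s ^ (K * L) = (-1) ^ L] (mod g)" if "g dvd s ^ K + 1" for g
  proof -
    have "[s ^ K = -1] (mod g)"
      using that by (simp add: cong_iff_dvd_diff)
    then have "[(s ^ K) ^ L = (-1) ^ L] (mod g)"
      by (rule cong_pow)
    then show ?thesis
      by (simp add: power_mult)
  qed
  have plus: "s + 1 dvd s ^ n + 1" if "odd n" for n
  proof -
    have "[s ^ n = (-1) ^ n] (mod (s + 1))"
      by (rule cong_pow[OF neg])
    then show ?thesis
      using that by (simp add: cong_iff_dvd_diff)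
  qed
  show "coprime (s ^ L + 1) (s ^ K + 1) \<longleftrightarrow> even K \<or> even L"
  proof
    assume "coprime (s ^ L + 1) (s ^ K + 1)"
    then show "even K \<or> even L"
      using plus s1 coprime_common_divisor by blast
  next
    assume ev: "even K \<or> even L"
    show "coprime (s ^ L + 1) (s ^ K + 1)"
    proof (rule coprimeI)
      fix g assume g: "g dvd s ^ L + 1" "g dvd s ^ K + 1"
      then have "[s ^ L = -1] (mod g)"
        by (simp add: cong_iff_dvd_diff)
      then have "[(s ^ L) ^ K = (-1) ^ K] (mod g)"
        by (rule cong_pow)
      then have "[s ^ (K * L) = (-1) ^ K] (mod g)"
        by (simp add: mult.commute flip: power_mult)
      then have "[(-1) ^ K = (-1) ^ L] (mod g)"
        using pows[OF g(2)] by (metis cong_sym cong_trans)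
      then have "g dvd 2 \<or> g dvd -2"
        using ev parity by (auto simp: cong_iff_dvd_diff)
      then show "is_unit g"
        using unit g by auto
    qed
  qed
  show "coprime (s ^ L - 1) (s ^ K + 1) \<longleftrightarrow> odd L"
  proof
    assume co: "coprime (s ^ L - 1) (s ^ K + 1)"
    show "odd L"
    proof
      assume "even L"
      have "[s ^ L = (-1) ^ L] (mod (s + 1))"
        by (rule cong_pow[OF neg])
      then have "s + 1 dvd s ^ L - 1"
        using \<open>even L\<close> by (simp add: cong_iff_dvd_diff)
      moreover have "odd K"
        using parity \<open>even L\<close> by simp
      ultimately show False
        using plus s1 co coprime_common_divisor by blast
    qed
  next
    assume odd: "odd L"
    show "coprime (s ^ L - 1) (s ^ K + 1)"
    proof (rule coprimeI)
      fix g assume g: "g dvd s ^ L - 1" "g dvd s ^ K + 1"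
      then have "[s ^ L = 1] (mod g)"
        by (simp add: cong_iff_dvd_diff)
      then have "[(s ^ L) ^ K = 1 ^ K] (mod g)"
        by (rule cong_pow)
      then have "[s ^ (K * L) = 1] (mod g)"
        by (simp add: mult.commute flip: power_mult)
      then have "[1 = (-1) ^ L] (mod g)"
        using pows[OF g(2)] by (metis cong_sym cong_trans)
      then have "g dvd 2"
        using odd by (simp add: cong_iff_dvd_diff)
      then show "is_unit g"
        using unit g by auto
    qed
  qed
qed

subsection \<open>Conjugation of a quadratic extension\<close>

locale quadratic_extension =
  fixes p k q :: nat and bar :: "'a::finite_field \<Rightarrow> 'a"
  assumes prime_p: "prime p" and k_pos: "k > 0" and q_eq: "q = p ^ k"
    and CARD_eq: "CARD('a) = q ^ 2" and bar_eq: "bar x = x ^ q"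
begin

text \<open>Translation by 1 permutes the field, so comparing the sums of all elements shows that
  the cardinality, a power of \<open>p\<close>, is zero in the field.\<close>

lemma CHAR_eq: "CHAR('a) = p"
proof -
  have "(\<Sum>x\<in>UNIV. x + 1) = (\<Sum>x\<in>(UNIV :: 'a set). x)"
    by (rule sum.reindex_bij_witness[of _ "\<lambda>x. x - 1" "\<lambda>x. x + 1"]) auto
  then have "of_nat (CARD('a)) = (0::'a)"
    by (simp add: sum.distrib)
  then have "CHAR('a) dvd CARD('a)"
    by (simp only: of_nat_eq_0_iff_char_dvd)
  then have "CHAR('a) dvd p ^ (k * 2)"
    by (simp add: CARD_eq q_eq power_mult)
  then have "CHAR('a) dvd p"
    using prime_dvd_power CHAR_prime by blast
  then show ?thesis
    using prime_p CHAR_prime primes_dvd_imp_eq by blast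
qed

lemma q_gt_1: "q > 1"
  unfolding q_eq using prime_gt_1_nat[OF prime_p] k_pos by (rule one_less_power)

lemma bar_add [simp]: "bar (x + y) = bar x + bar y"
  unfolding bar_eq by (rule freshmans_dream'[where n = k]) (simp_all add: CHAR_eq prime_p q_eq)

lemma bar_mult [simp]: "bar (x * y) = bar x * bar y"
  by (simp add: bar_eq power_mult_distrib)

lemma bar_0 [simp]: "bar 0 = 0" and bar_1 [simp]: "bar 1 = 1"
  using q_gt_1 by (simp_all add: bar_eq)

lemma bar_bar [simp]: "bar (bar x) = x"
  using finite_field_power_card_eq_same[of x]
  by (simp add: bar_eq CARD_eq power2_eq_square flip: power_mult)

lemma bar_eq_iff [simp]: "bar x = bar y \<longleftrightarrow> x = y"
  by (metis bar_bar)

lemma bar_eq_0_iff [simp]: "bar x = 0 \<longleftrightarrow> x = 0"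
  using bar_eq_iff[of x 0] by simp

lemma bar_minus [simp]: "bar (- x) = - bar x"
  using bar_add[of x "- x"] by (simp add: eq_neg_iff_add_eq_0 add.commute)

lemma bar_diff [simp]: "bar (x - y) = bar x - bar y"
  using bar_add[of x "- y"] by simp

lemma bar_power [simp]: "bar (x ^ n) = bar x ^ n"
  by (simp add: bar_eq flip: power_mult) (simp add: mult.commute)

lemma bar_divide [simp]: "bar (x / y) = bar x / bar y"
  by (simp add: bar_eq power_divide)

lemma power_q_plus_1: "x ^ (q + 1) = x * bar x"
  by (simp add: bar_eq power_add mult.commute)

lemma card_minus_1_eq: "(q - 1) * (q + 1) = CARD('a) - 1"
proof -
  obtain n where "q = Suc n"
    using q_gt_1 by (cases q) auto
  then show ?thesis
    by (simp add: CARD_eq power2_eq_square distrib_left)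
qed

lemma card_minus_1_eq': "(q + 1) * (q - 1) = CARD('a) - 1"
  using card_minus_1_eq by (simp add: mult.commute)

lemma power_q_minus_1: "x \<noteq> 0 \<Longrightarrow> x ^ (q - 1) = bar x / x"
  using q_gt_1 by (simp add: bar_eq power_diff)

lemma fixed_iff: "bar x = x \<longleftrightarrow> x = 0 \<or> x ^ (q - 1) = 1"
  by (cases "x = 0") (auto simp: power_q_minus_1)

lemma card_fixed: "card {x. bar x = x} = q"
proof -
  have "{x. bar x = x} = insert 0 {x. x ^ (q - 1) = 1}"
    using fixed_iff by auto
  moreover have "(0::'a) ^ (q - 1) \<noteq> 1"
    using q_gt_1 by (simp add: zero_power)
  ultimately show ?thesis
    using roots_of_unity_finite_field(2)[OF card_minus_1_eq] q_gt_1 by simp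
qed

lemma norm_1_imp_quotient:
  assumes "x * bar x = 1"
  obtains z where "z \<noteq> 0" "bar z = x * z"
proof -
  have "x \<in> {x. x ^ (q + 1) = 1}"
    using assms by (simp only: power_q_plus_1 mem_Collect_eq)
  then obtain z where "z \<noteq> 0" "x = z ^ (q - 1)"
    unfolding roots_of_unity_finite_field(1)[OF card_minus_1_eq'] by blast
  then show ?thesis
    using that by (simp add: power_q_minus_1)
qed

lemma ex_not_fixed: "\<exists>x. bar x \<noteq> x"
proof (rule ccontr)
  assume "\<not> ?thesis"
  then have "{x. bar x = x} = UNIV"
    by auto
  then show False
    using card_fixed CARD_eq q_gt_1 by (simp add: power2_eq_square)
qed

text \<open>Linear independence of the identity and the conjugation, tested at 1 and at one element
  outside the subfield.\<close>

lemma semilinear_eq_0: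
  assumes "\<And>w. u * w + v * bar w = 0"
  shows "u = 0" "v = 0"
proof -
  obtain x where x: "bar x \<noteq> x"
    using ex_not_fixed by blast
  have "u + v = 0"
    using assms[of 1] by simp
  then have "v = - u"
    by (simp add: eq_neg_iff_add_eq_0 add.commute)
  then have "u * (x - bar x) = 0"
    using assms[of x] by (simp add: algebra_simps)
  then show "u = 0" "v = 0"
    using x \<open>v = - u\<close> by auto
qed

text \<open>A counting argument that is uniform in the characteristic: \<open>f\<close> maps a pair
  of roots to the coefficients, and the pairs in \<open>S\<close> (both in the subfield, or
  conjugate and outside it) are numerous enough to hit all \<open>q * q\<close> coefficient
  pairs.\<close>

lemma quadratic_has_root:
  assumes u: "bar u = u" and v: "bar v = v"
  shows "\<exists>y. y * y + u * y + v = 0"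
proof -
  let ?K = "{x. bar x = x}"
  define f :: "'a \<times> 'a \<Rightarrow> 'a \<times> 'a" where "f = (\<lambda>(x, y). (- (x + y), x * y))"
  define S where "S = (?K \<times> ?K) \<union> (\<lambda>x. (x, bar x)) ` (- ?K)"
  have disj: "(?K \<times> ?K) \<inter> (\<lambda>x. (x, bar x)) ` (- ?K) = {}"
    by auto
  have "card ((\<lambda>x. (x, bar x)) ` (- ?K)) = q * q - q"
    by (subst card_image) (auto simp: inj_on_def Compl_eq_Diff_UNIV card_Diff_subset card_fixed CARD_eq power2_eq_square)
  then have cardS: "card S = q * q + (q * q - q)"
    unfolding S_def by (subst card_Un_disjoint[OF _ _ disj]) (simp_all add: card_cartesian_product card_fixed)
  have im: "f ` S \<subseteq> ?K \<times> ?K"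
    by (auto simp: f_def S_def algebra_simps)
  have fib: "b = a \<or> b = (snd a, fst a)" if "f a = f b" for a b :: "'a \<times> 'a"
  proof -
    obtain a1 a2 b1 b2 where ab: "a = (a1, a2)" "b = (b1, b2)"
      by (metis surj_pair)
    have "- (a1 + a2) = - (b1 + b2)" and eq2: "a1 * a2 = b1 * b2"
      using that by (simp_all only: f_def ab prod.case prod.inject)
    then have eq1: "a1 + a2 = b1 + b2"
      by (simp only: neg_equal_iff_equal)
    have "(b1 - a1) * (b1 - a2) = b1 * b1 - (a1 + a2) * b1 + a1 * a2"
      by (simp add: algebra_simps)
    also have "\<dots> = 0"
      unfolding eq1 eq2 by (simp add: algebra_simps)
    finally show ?thesis
      using eq1 by (auto simp: ab)
  qed
  text \<open>Off the diagonal of \<^term>\<open>S\<close> the map is exactly two-to-one, so that counting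
    \<^term>\<open>S\<close> together with the diagonal gives twice the size of the image.\<close>
  define D where "D = (\<lambda>x::'a. (x, x)) ` ?K"
  have DS: "D \<subseteq> S"
    by (auto simp: D_def S_def)
  have cardD: "card D = q"
    unfolding D_def by (subst card_image) (auto simp: inj_on_def card_fixed)
  have "card S + card D \<le> 2 * card (f ` S)"
  proof -
    have "card S + card D = (\<Sum>z\<in>f ` S. card {a \<in> S. f a = z} + card {a \<in> D. f a = z})"
    proof -
      have "card S = (\<Sum>z\<in>f ` S. card {a \<in> S. f a = z})"
        by (subst card_eq_sum, subst sum.image_gen[of _ _ f]) auto
      moreover have "card D = (\<Sum>z\<in>f ` S. card {a \<in> D. f a = z})"
      proof -
        have "card D = (\<Sum>z\<in>f ` D. card {a \<in> D. f a = z})"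
          by (subst card_eq_sum, subst sum.image_gen[of _ _ f]) auto
        also have "\<dots> = (\<Sum>z\<in>f ` S. card {a \<in> D. f a = z})"
        proof (rule sum.mono_neutral_left)
          show "f ` D \<subseteq> f ` S"
            using DS by (rule image_mono)
          show "\<forall>z\<in>f ` S - f ` D. card {a \<in> D. f a = z} = 0"
          proof
            fix z assume "z \<in> f ` S - f ` D"
            then have "{a \<in> D. f a = z} = {}"
              by blast
            then show "card {a \<in> D. f a = z} = 0"
              by (simp only: card.empty)
          qed
        qed simp
        finally show ?thesis .
      qed
      ultimately show ?thesis
        by (simp add: sum.distrib)
    qed
    also have "\<dots> \<le> (\<Sum>z\<in>f ` S. 2)"
    proof (intro sum_mono)
      fix z assume "z \<in> f ` S"
      then obtain a where a: "a \<in> S" "z = f a"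
        by blast
      define a' where "a' = (snd a, fst a)"
      have "{b \<in> S. f b = z} \<subseteq> {a, a'}"
      proof
        fix b assume "b \<in> {b \<in> S. f b = z}"
        then have "f a = f b"
          using a by simp
        then show "b \<in> {a, a'}"
          unfolding a'_def using fib by blast
      qed
      moreover have "{b \<in> D. f b = z} \<subseteq> (if a = a' then {a} else {})"
      proof
        fix b assume "b \<in> {b \<in> D. f b = z}"
        then have "f a = f b" and "snd b = fst b"
          using a by (simp_all add: D_def image_iff) auto
        then have "(b = a \<or> b = a') \<and> a = a'"
          unfolding a'_def using fib[of a b] by (auto simp: prod_eq_iff)
        then show "b \<in> (if a = a' then {a} else {})"
          by auto
      qed
      ultimately have "card {b \<in> S. f b = z} + card {b \<in> D. f b = z}
          \<le> card {a, a'} + card (if a = a' then {a} else {})"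
        by (intro add_mono card_mono) simp_all
      also have "\<dots> \<le> 2"
        by (simp add: card_insert_if)
      finally show "card {a \<in> S. f a = z} + card {a \<in> D. f a = z} \<le> 2" .
    qed
    finally show ?thesis
      by (simp add: mult.commute)
  qed
  \<comment> \<open>The left side of the estimate, \<open>card S + card D\<close>, is exactly twice
    \<open>q * q\<close>.\<close>
  then have "q * q \<le> card (f ` S)"
    using cardS cardD q_gt_1 by (simp add: algebra_simps)
  then have "f ` S = ?K \<times> ?K"
    using im by (intro card_seteq) (auto simp: card_cartesian_product card_fixed)
  then have "(u, v) \<in> f ` S"
    using u v by simp
  then obtain z where "(u, v) = f z"
    by blast
  then obtain x y where "u = - (x + y)" "v = x * y"
    by (cases z) (simp only: f_def prod.case prod.inject)
  moreover have "x * x + (- (x + y)) * x + x * y = 0"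
    by (simp add: algebra_simps)
  ultimately show ?thesis
    by blast
qed

end

subsection \<open>Maps on lines over the subfield\<close>

locale frobenius_pair = quadratic_extension p k q bar
  for p k q :: nat and bar :: "'a::finite_field \<Rightarrow> 'a" +
  fixes l Q :: nat and fr :: "'a \<Rightarrow> 'a"
  assumes Q_eq: "Q = p ^ l" and fr_eq: "fr x = x ^ Q"
begin

lemma Q_pos: "Q > 0"
  using prime_gt_0_nat[OF prime_p] by (simp add: Q_eq)

lemma fr_add [simp]: "fr (x + y) = fr x + fr y"
  unfolding fr_eq by (rule freshmans_dream'[where n = l]) (simp_all add: CHAR_eq prime_p Q_eq)

lemma fr_mult [simp]: "fr (x * y) = fr x * fr y"
  by (simp add: fr_eq power_mult_distrib)

lemma fr_0 [simp]: "fr 0 = 0" and fr_1 [simp]: "fr 1 = 1"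
  using Q_pos by (simp_all add: fr_eq)

lemma fr_eq_0_iff [simp]: "fr x = 0 \<longleftrightarrow> x = 0"
  using Q_pos by (simp add: fr_eq)

lemma fr_minus [simp]: "fr (- x) = - fr x"
  using fr_add[of x "- x"] by (simp add: eq_neg_iff_add_eq_0 add.commute)

lemma fr_diff [simp]: "fr (x - y) = fr x - fr y"
  using fr_add[of x "- y"] by simp

lemma fr_divide [simp]: "fr (x / y) = fr x / fr y"
  by (simp add: fr_eq power_divide)

lemma fr_eq_iff [simp]: "fr x = fr y \<longleftrightarrow> x = y"
  using fr_eq_0_iff[of "x - y"] by auto

lemma bar_fr [simp]: "bar (fr x) = fr (bar x)"
  by (simp add: fr_eq)

lemma fr_surj: obtains x where "fr x = y"
proof -
  have "inj fr"
    by (simp add: inj_def)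
  then have "surj fr"
    by (simp add: finite_UNIV_inj_surj)
  then show ?thesis
    using that by (metis surjD)
qed

lemma fr_surj_fixed:
  assumes "bar y = y"
  obtains x where "fr x = y" "bar x = x"
proof -
  obtain x where x: "fr x = y"
    using fr_surj by blast
  then have "fr (bar x) = fr x"
    using assms by (metis bar_fr)
  then have "bar x = x"
    by (simp only: fr_eq_iff)
  then show ?thesis
    using that x by blast
qed

text \<open>Two nonzero elements are parallel iff they span the same line over the subfield
  with \<^term>\<open>q\<close> elements.\<close>
definition par :: "'a \<Rightarrow> 'a \<Rightarrow> bool" where
  "par z w \<longleftrightarrow> z * bar w = bar z * w"

lemma par_sym: "par z w \<longleftrightarrow> par w z"
  by (auto simp: par_def mult.commute)

lemma par_0 [simp]: "par 0 w" "par z 0"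
  by (simp_all add: par_def)

lemma par_refl [simp]: "par z z"
  by (simp add: par_def mult.commute)

lemma par_scale_left: "bar t = t \<Longrightarrow> t \<noteq> 0 \<Longrightarrow> par (t * z) w \<longleftrightarrow> par z w"
  by (simp add: par_def mult.assoc)

lemma par_scale_right: "bar t = t \<Longrightarrow> t \<noteq> 0 \<Longrightarrow> par z (t * w) \<longleftrightarrow> par z w"
  by (metis par_scale_left par_sym)

lemma par_mult_self: "bar t = t \<Longrightarrow> par (t * w) w"
  by (simp add: par_def)

lemma parE:
  assumes "par z w" "w \<noteq> 0"
  obtains t where "bar t = t" "z = t * w"
proof (rule that)
  show "z = (z / w) * w"
    using assms by simp
  show "bar (z / w) = z / w"
    using assms by (simp add: par_def frac_eq_eq mult.commute)
qed

lemma par_trans: "par x y \<Longrightarrow> par y z \<Longrightarrow> y \<noteq> 0 \<Longrightarrow> par x z"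
  by (metis mult_eq_0_iff par_mult_self par_scale_left parE par_0(1))

text \<open>Cramer's rule for \<open>z\<close> and its conjugate: the determinant \<open>?D\<close>
  and both numerators are negated by conjugation, so the quotients lie in the subfield.\<close>

lemma not_par_span:
  assumes "\<not> par u v"
  obtains x y where "bar x = x" "bar y = y" "z = x * u + y * v"
proof (rule that)
  let ?D = "u * bar v - bar u * v"
  have D: "?D \<noteq> 0"
    using assms by (simp add: par_def)
  have D': "bar ?D = - ?D"
    by (simp add: algebra_simps)
  let ?x = "(z * bar v - bar z * v) / ?D" and ?y = "(u * bar z - bar u * z) / ?D"
  have "bar (z * bar v - bar z * v) = - (z * bar v - bar z * v)"
    by (simp add: algebra_simps)
  then show "bar ?x = ?x"
    unfolding bar_divide D' by (simp only: minus_divide_divide)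
  have "bar (u * bar z - bar u * z) = - (u * bar z - bar u * z)"
    by (simp add: algebra_simps)
  then show "bar ?y = ?y"
    unfolding bar_divide D' by (simp only: minus_divide_divide)
  have "(z * bar v - bar z * v) * u + (u * bar z - bar u * z) * v = z * ?D"
    by (simp add: algebra_simps)
  then have "((z * bar v - bar z * v) * u + (u * bar z - bar u * z) * v) / ?D = z"
    by (simp only: nonzero_mult_div_cancel_right[OF D])
  then show "z = ?x * u + ?y * v"
    by (simp only: add_divide_distrib times_divide_eq_left)
qed

lemma not_par_imp_nonzero: "\<not> par u v \<Longrightarrow> u \<noteq> 0 \<and> v \<noteq> 0"
  by auto

section \<open>Injective maps on the projective line over the subfield\<close>

definition proj_inj :: "('a \<Rightarrow> 'a) \<Rightarrow> bool" where
  "proj_inj g \<longleftrightarrow> (\<forall>z. z \<noteq> 0 \<longrightarrow> g z \<noteq> 0) \<and>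
     (\<forall>z w. z \<noteq> 0 \<longrightarrow> w \<noteq> 0 \<longrightarrow> par (g z) (g w) \<longrightarrow> par z w)"

lemma proj_inj_nonzero: "proj_inj g \<Longrightarrow> z \<noteq> 0 \<Longrightarrow> g z \<noteq> 0"
  by (simp add: proj_inj_def)

lemma proj_injD: "proj_inj g \<Longrightarrow> z \<noteq> 0 \<Longrightarrow> w \<noteq> 0 \<Longrightarrow> par (g z) (g w) \<Longrightarrow> par z w"
  by (simp add: proj_inj_def)

text \<open>The general map of two variables that is bilinear over the subfield. Keeping the
  arguments independent separates the linear algebra from the Frobenius map that links them in
  \<open>G\<close>.\<close>

definition B :: "'a \<Rightarrow> 'a \<Rightarrow> 'a \<Rightarrow> 'a \<Rightarrow> 'a \<Rightarrow> 'a \<Rightarrow> 'a" where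
  "B a b c d w z = a * bar w * bar z + b * bar w * z + c * w * bar z + d * w * z"

definition G :: "'a \<Rightarrow> 'a \<Rightarrow> 'a \<Rightarrow> 'a \<Rightarrow> 'a \<Rightarrow> 'a" where
  "G a b c d z = B a b c d (fr z) z"

lemma power_surj_fixed:
  assumes "coprime r (q - 1)" "bar v = v" "v \<noteq> 0"
  obtains t where "bar t = t" "t \<noteq> 0" "t ^ r = v"
proof -
  let ?U = "{x::'a. x ^ (q - 1) = 1}"
  have co: "\<forall>x::'a. x ^ (q - 1) = 1 \<longrightarrow> x ^ r = 1 \<longrightarrow> x = 1"
    using assms(1) card_minus_1_eq power_inj_iff_coprime by (metis dvd_triv_left)
  have U0: "x \<noteq> 0" if "x \<in> ?U" for x
    using that q_gt_1 by (auto simp: zero_power)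
  have "inj_on (\<lambda>x. x ^ r) ?U"
  proof (rule inj_onI)
    fix x y assume xy: "x \<in> ?U" "y \<in> ?U" "x ^ r = y ^ r"
    then have "(x / y) ^ (q - 1) = 1" "(x / y) ^ r = 1"
      using U0[of y] by (simp_all add: power_divide)
    then have "x / y = 1"
      using co by blast
    then show "x = y"
      using U0[of y] xy by simp
  qed
  moreover have "(\<lambda>x. x ^ r) ` ?U \<subseteq> ?U"
    by auto (metis mult.commute power_mult power_one)
  ultimately have "(\<lambda>x. x ^ r) ` ?U = ?U"
    by (intro endo_inj_surj) auto
  moreover have "v \<in> ?U"
    using assms fixed_iff by simp
  ultimately obtain t where "t \<in> ?U" "v = t ^ r"
    by blast
  then show ?thesis
    using that[of t] U0[of t] fixed_iff[of t] by simp
qed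

text \<open>At nonzero \<open>z\<close> the polynomial agrees with \<open>G\<close> up to a nonzero
  factor in the subfield, and scaling \<open>z\<close> by a subfield unit \<open>t\<close> scales
  the value by \<open>t ^ r\<close>. Bijectivity thus splits into injectivity of the
  \<open>r\<close>-th power on the subfield units and injectivity of \<open>G\<close> on
  lines.\<close>

lemma permutation_poly_iff_proj_inj:
  assumes "r > 0" and cong: "[r = Q + 1] (mod (q + 1))"
  shows "permutation_poly (monom 1 r * pcompose (A_poly Q a b c d) (monom 1 (q - 1))) \<longleftrightarrow>
    gcd r (q - 1) = 1 \<and> proj_inj (G a b c d)"
proof -
  define F where "F = poly (monom 1 r * pcompose (A_poly Q a b c d) (monom 1 (q - 1)))"
  have F: "F z = z ^ r * (a * (z ^ (q - 1)) ^ (Q + 1) + b * (z ^ (q - 1)) ^ Q + c * z ^ (q - 1) + d)" for z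
    by (simp add: F_def A_poly_def poly_monom poly_pcompose)
  have F0 [simp]: "F 0 = 0"
    using \<open>r > 0\<close> by (simp add: F)
  have FG: "\<exists>t. bar t = t \<and> t \<noteq> 0 \<and> F z = t * G a b c d z" if z: "z \<noteq> 0" for z
  proof (intro exI conjI)
    \<comment> \<open>This factor lies in the subfield because \<open>y ^ (q + 1) = 1\<close>, so
      that \<open>y ^ r = y ^ (Q + 1)\<close> by the congruence on \<open>r\<close>.\<close>
    let ?t = "z ^ r / z ^ (Q + 1)"
    define y where "y = z ^ (q - 1)"
    have y: "y = bar z / z"
      using z by (simp add: y_def power_q_minus_1)
    have "y ^ (q + 1) = 1"
      unfolding y_def by (metis card_minus_1_eq power_CARD_minus_1 power_mult z)
    then have "y ^ n = y ^ (n mod (q + 1))" for n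
      by (metis mult_1 mult_div_mod_eq power_add power_mult power_one)
    then have "y ^ r = y ^ (Q + 1)"
      using cong unfolding cong_def by metis
    then have "?t ^ (q - 1) = 1"
      using z unfolding y_def power_divide by (simp add: mult.commute flip: power_mult)
    then show "bar ?t = ?t"
      using fixed_iff by blast
    show "?t \<noteq> 0"
      using z by simp
    have "z ^ (Q + 1) * (a * y ^ (Q + 1) + b * y ^ Q + c * y + d) = G a b c d z"
    proof -
      have yz: "y * z = bar z" "fr y * fr z = fr (bar z)"
        using z by (simp_all add: y)
      have "z ^ (Q + 1) * (a * y ^ (Q + 1) + b * y ^ Q + c * y + d)
          = a * (fr y * fr z) * (y * z) + b * (fr y * fr z) * z + c * fr z * (y * z) + d * fr z * z"
        by (simp add: power_add algebra_simps flip: fr_eq)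
      then show ?thesis
        unfolding yz by (simp add: G_def B_def)
    qed
    then have "?t * G a b c d z = z ^ r * (a * y ^ (Q + 1) + b * y ^ Q + c * y + d)"
      using z by (metis (no_types, lifting) mult.assoc nonzero_eq_divide_eq power_not_zero)
    then show "F z = ?t * G a b c d z"
      unfolding F y_def by simp
  qed
  have Fscale: "F (t * z) = t ^ r * F z" if "bar t = t" "t \<noteq> 0" for t z
  proof -
    have "t ^ (q - 1) = 1"
      using that fixed_iff by blast
    then show ?thesis
      by (simp add: F power_mult_distrib mult.assoc)
  qed
  have U: "coprime r (q - 1) \<longleftrightarrow> (\<forall>x::'a. x ^ (q - 1) = 1 \<longrightarrow> x ^ r = 1 \<longrightarrow> x = 1)"
    using card_minus_1_eq power_inj_iff_coprime by (metis dvd_triv_left)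
  have parF: "par (F z) (F w) \<longleftrightarrow> par (G a b c d z) (G a b c d w)" if zw: "z \<noteq> 0" "w \<noteq> 0" for z w
    using FG[OF zw(1)] FG[OF zw(2)] by (auto simp: par_scale_left par_scale_right)
  have "bij F \<longleftrightarrow> inj F"
    using finite_UNIV_inj_surj[of F] by (auto simp: bij_def)
  moreover have "inj F \<longleftrightarrow> coprime r (q - 1) \<and> proj_inj (G a b c d)"
  proof
    assume inj: "inj F"
    have "\<forall>x::'a. x ^ (q - 1) = 1 \<longrightarrow> x ^ r = 1 \<longrightarrow> x = 1"
    proof (intro allI impI)
      fix x :: 'a assume x: "x ^ (q - 1) = 1" "x ^ r = 1"
      then have "bar x = x" "x \<noteq> 0"
        using fixed_iff q_gt_1 by (auto simp: zero_power)
      then have "F (x * 1) = F 1"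
        using Fscale[of x 1] x by simp
      then show "x = 1"
        using inj by (simp add: inj_eq)
    qed
    then have co: "coprime r (q - 1)"
      by (simp only: U)
    have nz: "F z \<noteq> 0" if "z \<noteq> 0" for z
      using that inj_eq[OF inj, of z 0] by simp
    have "proj_inj (G a b c d)"
      unfolding proj_inj_def
    proof (intro conjI allI impI)
      fix z :: 'a assume "z \<noteq> 0"
      then show "G a b c d z \<noteq> 0"
        using FG[of z] nz[of z] by auto
    next
      fix z w :: 'a assume zw: "z \<noteq> 0" "w \<noteq> 0" and "par (G a b c d z) (G a b c d w)"
      then have "par (F z) (F w)"
        using parF by simp
      from parE[OF this nz[OF zw(2)]] obtain v where v: "bar v = v" "F z = v * F w" .
      then have "v \<noteq> 0"
        using nz[OF zw(1)] by auto
      \<comment> \<open>Rescaling \<open>w\<close> by an \<open>r\<close>-th root of the ratio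
        \<open>v\<close> turns parallel values into equal ones.\<close>
      from power_surj_fixed[OF co v(1) this] obtain t where t: "bar t = t" "t \<noteq> 0" "t ^ r = v" .
      then have "F z = F (t * w)"
        using v Fscale[of t w] by simp
      then have "z = t * w"
        using inj by (simp add: inj_eq)
      then show "par z w"
        using par_mult_self t by simp
    qed
    then show "coprime r (q - 1) \<and> proj_inj (G a b c d)"
      using co by blast
  next
    assume asm: "coprime r (q - 1) \<and> proj_inj (G a b c d)"
    have nz: "F z \<noteq> 0" if "z \<noteq> 0" for z
      using FG[OF that] asm proj_inj_nonzero[OF _ that] by auto
    show "inj F"
    proof (rule injI)
      fix z w assume eq: "F z = F w"
      show "z = w"
      proof (cases "w = 0")
        case True
        then have "F z = 0"
          using eq by simp
        then show ?thesis
          using nz[of z] True by blast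
      next
        case False
        then have "F z \<noteq> 0"
          using eq nz[of w] by simp
        then have "z \<noteq> 0"
          by (metis F0)
        then have "par z w"
          using parF[of z w] False asm proj_injD[of "G a b c d" z w] unfolding eq par_def by simp
        from parE[OF this False] obtain t where t: "bar t = t" "z = t * w" .
        then have "t \<noteq> 0"
          using \<open>z \<noteq> 0\<close> by auto
        then have "t ^ r * F w = F w"
          using Fscale[of t w] eq t by simp
        then have "t ^ r = 1"
          using nz False by simp
        moreover have "t ^ (q - 1) = 1"
          using t \<open>t \<noteq> 0\<close> fixed_iff by blast
        ultimately have "t = 1"
          using asm unfolding U by blast
        then show ?thesis
          using t by simp
      qed
    qed
  qed
  ultimately show ?thesis
    unfolding permutation_poly_def F_def by (simp add: coprime_iff_gcd_eq_1)
qed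

section \<open>Linear maps over the subfield\<close>

definition lin :: "'a \<Rightarrow> 'a \<Rightarrow> 'a \<Rightarrow> 'a" where
  "lin u v z = u * z + v * bar z"

text \<open>The expression \<open>z * bar w - bar z * w\<close> is alternating over the subfield, so
  \<open>lin u v\<close> multiplies it by its determinant
  \<open>u * bar u - v * bar v\<close>.\<close>

lemma par_lin_iff:
  assumes "u * bar u \<noteq> v * bar v"
  shows "par (lin u v z) (lin u v w) \<longleftrightarrow> par z w"
proof -
  have "lin u v z * bar (lin u v w) - bar (lin u v z) * lin u v w
      = (u * bar u - v * bar v) * (z * bar w - bar z * w)"
    by (simp add: lin_def algebra_simps)
  then show ?thesis
    using assms by (auto simp: par_def)
qed

lemma lin_eq_0_iff:
  assumes "u * bar u \<noteq> v * bar v"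
  shows "lin u v z = 0 \<longleftrightarrow> z = 0"
proof -
  have "bar u * lin u v z - v * bar (lin u v z) = (u * bar u - v * bar v) * z"
    by (simp add: lin_def algebra_simps)
  moreover have "lin u v 0 = 0"
    by (simp add: lin_def)
  ultimately show ?thesis
    using assms by (metis bar_0 diff_self mult_eq_0_iff mult_zero_right right_minus_eq)
qed

text \<open>The inner map is the adjugate of \<open>lin u v\<close> divided by the determinant
  \<open>d\<close>.\<close>

lemma lin_lin_inverse:
  assumes d: "d = u * bar u - v * bar v" "d \<noteq> 0"
  shows "lin u v (lin (bar u / d) (- v / d) z) = z"
proof -
  have "bar d = d"
    by (simp add: d algebra_simps)
  then have "lin u v (lin (bar u / d) (- v / d) z) = (u * bar u - v * bar v) * z / d"
    by (simp add: lin_def field_simps d(2))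
  then show ?thesis
    using d by simp
qed

lemma proj_inj_lin_comp:
  assumes "u * bar u \<noteq> v * bar v"
  shows "proj_inj (\<lambda>z. lin u v (g z)) \<longleftrightarrow> proj_inj g"
  by (simp add: proj_inj_def lin_eq_0_iff[OF assms] par_lin_iff[OF assms])

lemma proj_inj_comp_lin:
  assumes uv: "u * bar u \<noteq> v * bar v"
  shows "proj_inj (\<lambda>z. g (lin u v z)) \<longleftrightarrow> proj_inj g"
proof -
  define d where "d = u * bar u - v * bar v"
  then have "d \<noteq> 0"
    using uv by simp
  then have surj: "\<exists>z. y = lin u v z" for y
    using lin_lin_inverse[OF d_def, of y] by metis
  show ?thesis
  proof
    assume P: "proj_inj (\<lambda>z. g (lin u v z))"
    show "proj_inj g"
      unfolding proj_inj_def
    proof (intro conjI allI impI)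
      fix z :: 'a assume "z \<noteq> 0"
      moreover obtain z' where "z = lin u v z'"
        using surj by blast
      ultimately show "g z \<noteq> 0"
        using P lin_eq_0_iff[OF uv] by (simp add: proj_inj_def)
    next
      fix z w :: 'a assume "z \<noteq> 0" "w \<noteq> 0" "par (g z) (g w)"
      moreover obtain z' w' where "z = lin u v z'" "w = lin u v w'"
        using surj by metis
      ultimately show "par z w"
        using P lin_eq_0_iff[OF uv] par_lin_iff[OF uv] by (simp add: proj_inj_def)
    qed
  next
    assume "proj_inj g"
    then show "proj_inj (\<lambda>z. g (lin u v z))"
      unfolding proj_inj_def using lin_eq_0_iff[OF uv] par_lin_iff[OF uv] by blast
  qed
qed

text \<open>By Hilbert 90 the ratio \<open>bar z / z\<close> identifies lines with the unit circle,
  where the map becomes the \<open>n\<close>-th power on roots of unity of exponent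
  \<open>q + 1\<close>.\<close>

lemma proj_inj_power_iff:
  "proj_inj (\<lambda>z. z ^ n) \<longleftrightarrow> coprime n (q + 1)"
proof -
  have "coprime n (q + 1) \<longleftrightarrow> (\<forall>x::'a. x ^ (q + 1) = 1 \<longrightarrow> x ^ n = 1 \<longrightarrow> x = 1)"
    using card_minus_1_eq' power_inj_iff_coprime by (metis dvd_triv_left)
  also have "\<dots> \<longleftrightarrow> proj_inj (\<lambda>z. z ^ n)"
  proof
    assume R: "\<forall>x::'a. x ^ (q + 1) = 1 \<longrightarrow> x ^ n = 1 \<longrightarrow> x = 1"
    show "proj_inj (\<lambda>z. z ^ n)"
      unfolding proj_inj_def
    proof (intro conjI allI impI)
      fix z w :: 'a assume zw: "z \<noteq> 0" "w \<noteq> 0" and "par (z ^ n) (w ^ n)"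
      define x where "x = (bar z / z) / (bar w / w)"
      have "x ^ (q + 1) = 1"
        using zw unfolding power_q_plus_1 by (simp add: x_def)
      moreover have "x ^ n = 1"
        using zw \<open>par (z ^ n) (w ^ n)\<close>
        by (simp add: x_def par_def power_divide power_mult_distrib field_simps)
      ultimately have "x = 1"
        using R by blast
      then show "par z w"
        using zw by (simp add: x_def par_def field_simps)
    qed simp
  next
    assume P: "proj_inj (\<lambda>z. z ^ n)"
    show "\<forall>x::'a. x ^ (q + 1) = 1 \<longrightarrow> x ^ n = 1 \<longrightarrow> x = 1"
    proof (intro allI impI)
      fix x :: 'a assume x: "x ^ (q + 1) = 1" "x ^ n = 1"
      then obtain z where z: "z \<noteq> 0" "bar z = x * z"
        using norm_1_imp_quotient power_q_plus_1 by metis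
      then have "par (z ^ n) (1 ^ n)"
        using x by (simp add: par_def power_mult_distrib)
      then have "par z 1"
        using P z proj_injD by (metis one_neq_zero)
      then show "x = 1"
        using z by (simp add: par_def)
    qed
  qed
  finally show ?thesis
    by simp
qed

lemma par_combination_iff:
  assumes "\<not> par u v" "bar x = x" "bar y = y" "bar x' = x'" "bar y' = y'"
  shows "par (x * u + y * v) (x' * u + y' * v) \<longleftrightarrow> x * y' = y * x'"
proof -
  have "(x * u + y * v) * bar (x' * u + y' * v) - bar (x * u + y * v) * (x' * u + y' * v)
      = (x * y' - y * x') * (u * bar v - bar u * v)"
    by (simp add: assms algebra_simps)
  then show ?thesis
    using assms(1) by (auto simp: par_def)
qed

lemma combination_eq_0:
  assumes "\<not> par u v" "bar x = x" "bar y = y" "x * u + y * v = 0"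
  shows "x = 0" "y = 0"
proof -
  have "par (x * u + y * v) (1 * u + 0 * v)" "par (x * u + y * v) (0 * u + 1 * v)"
    by (simp_all only: assms(4) par_0)
  then show "x = 0" "y = 0"
    unfolding par_combination_iff[OF assms(1-3) bar_1 bar_0]
      par_combination_iff[OF assms(1-3) bar_0 bar_1] by simp_all
qed

text \<open>In the coordinate \<open>x / y\<close> the map is the power with exponent
  \<open>Q + 1\<close> on the projective line over the subfield, so only its injectivity on the
  subfield units is at stake.\<close>

lemma proj_inj_diagonal_iff:
  assumes zw: "\<not> par z0 w0" and g01: "\<not> par g0 g1"
    and g: "\<And>x y. bar x = x \<Longrightarrow> bar y = y \<Longrightarrow> g (x * z0 + y * w0) = fr x * x * g0 + fr y * y * g1"
  shows "proj_inj g \<longleftrightarrow> coprime (Q + 1) (q - 1)"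
proof -
  have pow: "fr x * x = x ^ (Q + 1)" for x
    by (simp add: fr_eq power_add)
  have "coprime (Q + 1) (q - 1) \<longleftrightarrow> (\<forall>x::'a. x ^ (q - 1) = 1 \<longrightarrow> x ^ (Q + 1) = 1 \<longrightarrow> x = 1)"
    using card_minus_1_eq power_inj_iff_coprime by (metis dvd_triv_left)
  also have "\<dots> \<longleftrightarrow> proj_inj g"
  proof
    assume R: "\<forall>x::'a. x ^ (q - 1) = 1 \<longrightarrow> x ^ (Q + 1) = 1 \<longrightarrow> x = 1"
    have inj: "x = y" if "bar x = x" "bar y = y" "fr x * x = fr y * y" for x y
    proof (cases "y = 0")
      case True
      then show ?thesis
        using that by simp
    next
      case False
      then have "x \<noteq> 0"
        using that by auto
      then have "(x / y) ^ (q - 1) = 1"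
        using that False fixed_iff by (simp add: power_divide)
      moreover have "(x / y) ^ (Q + 1) = 1"
        using that False by (simp add: power_divide flip: pow)
      ultimately show ?thesis
        using R False by (metis divide_self_if frac_eq_eq mult_1 right_inverse_eq)
    qed
    show "proj_inj g"
      unfolding proj_inj_def
    proof (intro conjI allI impI)
      fix z :: 'a assume "z \<noteq> 0"
      obtain x y where xy: "bar x = x" "bar y = y" "z = x * z0 + y * w0"
        using not_par_span[OF zw] by blast
      show "g z \<noteq> 0"
      proof
        assume "g z = 0"
        then have "fr x * x * g0 + fr y * y * g1 = 0"
          using g xy by simp
        then have "fr x * x = 0" "fr y * y = 0"
          using combination_eq_0[OF g01, of "fr x * x" "fr y * y"] xy by simp_all
        then show False
          using xy \<open>z \<noteq> 0\<close> by simp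
      qed
    next
      fix z w :: 'a assume par: "par (g z) (g w)"
      obtain x y where xy: "bar x = x" "bar y = y" "z = x * z0 + y * w0"
        using not_par_span[OF zw] by blast
      obtain x' y' where xy': "bar x' = x'" "bar y' = y'" "w = x' * z0 + y' * w0"
        using not_par_span[OF zw] by blast
      have "par (fr x * x * g0 + fr y * y * g1) (fr x' * x' * g0 + fr y' * y' * g1)"
        using par g xy xy' by simp
      then have "fr x * x * (fr y' * y') = fr y * y * (fr x' * x')"
        using xy xy' by (subst (asm) par_combination_iff[OF g01]) simp_all
      then have "fr (x * y') * (x * y') = fr (y * x') * (y * x')"
        by (simp add: mult_ac)
      then have "x * y' = y * x'"
        using inj[of "x * y'" "y * x'"] xy xy' by simp
      then show "par z w"
        using xy xy' by (simp add: par_combination_iff[OF zw])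
    qed
  next
    assume P: "proj_inj g"
    show "\<forall>x::'a. x ^ (q - 1) = 1 \<longrightarrow> x ^ (Q + 1) = 1 \<longrightarrow> x = 1"
    proof (intro allI impI)
      fix x :: 'a assume x: "x ^ (q - 1) = 1" "x ^ (Q + 1) = 1"
      then have bx: "bar x = x"
        using fixed_iff by blast
      \<comment> \<open>Since \<open>x\<close> and 1 have the same power with exponent
        \<open>Q + 1\<close>, the lines with coordinates \<open>(x, 1)\<close> and
        \<open>(1, 1)\<close> have the same image.\<close>
      have "g (x * z0 + 1 * w0) = g (1 * z0 + 1 * w0)"
        using x bx g[of x 1] g[of 1 1] by (simp add: pow)
      moreover have "x * z0 + 1 * w0 \<noteq> 0" "1 * z0 + 1 * w0 \<noteq> 0"
        using combination_eq_0(2)[OF zw, of x 1] combination_eq_0(2)[OF zw, of 1 1] bx by force+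
      ultimately have "par (x * z0 + 1 * w0) (1 * z0 + 1 * w0)"
        using proj_injD[OF P, of "x * z0 + 1 * w0" "1 * z0 + 1 * w0"] by simp
      then show "x = 1"
        using bx by (simp only: par_combination_iff[OF zw] bar_1) simp
    qed
  qed
  finally show ?thesis
    by simp
qed

section \<open>Coordinate changes and normal forms of \<open>B\<close>\<close>

lemma B_lin:
  "B a b c d (lin (fr u) (fr v) w) (lin u v z) =
     B (a * fr (bar u) * bar u + b * fr (bar u) * v + c * fr v * bar u + d * fr v * v)
       (a * fr (bar u) * bar v + b * fr (bar u) * u + c * fr v * bar v + d * fr v * u)
       (a * fr (bar v) * bar u + b * fr (bar v) * v + c * fr u * bar u + d * fr u * v)
       (a * fr (bar v) * bar v + b * fr (bar v) * u + c * fr u * bar v + d * fr u * u) w z"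
  by (simp add: B_def lin_def algebra_simps)

text \<open>The reason for the twist in \<open>B_lin\<close>: substituting \<open>lin u v z\<close>
  for \<open>z\<close> forces this map on the first argument, so that \<open>G\<close> passes to the
  \<open>G\<close> of the new coefficients.\<close>

lemma fr_lin: "fr (lin u v z) = lin (fr u) (fr v) (fr z)"
  by (simp add: lin_def)

lemma B_eqD:
  assumes "\<And>w z. B a b c d w z = B a' b' c' d' w z"
  shows "a = a'" "b = b'" "c = c'" "d = d'"
proof -
  have "((d - d') * w + (b - b') * bar w) * z + ((c - c') * w + (a - a') * bar w) * bar z = 0" for w z
    using assms[of w z] by (simp add: B_def algebra_simps)
  from semilinear_eq_0[OF this]
  have 1: "(d - d') * w + (b - b') * bar w = 0" "(c - c') * w + (a - a') * bar w = 0" for w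
    by blast+
  from semilinear_eq_0[OF 1(1)] semilinear_eq_0[OF 1(2)]
  show "a = a'" "b = b'" "c = c'" "d = d'"
    by simp_all
qed

lemma G_combination:
  assumes "bar x = x" "bar y = y"
  shows "G a b c d (x * z + y * w) = fr x * x * G a b c d z + fr x * y * B a b c d (fr z) w
    + fr y * x * B a b c d (fr w) z + fr y * y * G a b c d w"
proof -
  have "bar (fr x) = fr x" "bar (fr y) = fr y"
    using assms by simp_all
  then show ?thesis
    using assms by (simp add: G_def B_def algebra_simps)
qed

text \<open>The determinant of the linear map in \<open>w\<close> displayed in
  \<open>B_eq_lin\<close>; as a function of \<open>z\<close> it is the quadratic form
  \<open>R\<close>.\<close>

definition kernel_form :: "'a \<Rightarrow> 'a \<Rightarrow> 'a \<Rightarrow> 'a \<Rightarrow> 'a \<Rightarrow> 'a" where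
  "kernel_form a b c d z = (c * bar z + d * z) * bar (c * bar z + d * z) - (a * bar z + b * z) * bar (a * bar z + b * z)"

lemma B_eq_lin: "B a b c d w z = lin (c * bar z + d * z) (a * bar z + b * z) w"
  by (simp add: B_def lin_def algebra_simps)

lemma kernel_form_eq:
  "kernel_form a b c d z = (c * bar d - a * bar b) * (bar z * bar z)
     + (c * bar c + d * bar d - a * bar a - b * bar b) * (z * bar z)
     + bar (c * bar d - a * bar b) * (z * z)"
  by (simp add: kernel_form_def algebra_simps)

text \<open>Here the zeros of \<open>R\<close> are two lines spanned by elements \<open>z\<close>,
  \<open>w\<close> of the field, which serve as a basis; in \<open>twisted_diagonal\<close> the
  coordinates are a conjugate pair instead. The last condition excludes a degenerate image.\<close>

definition rational_diagonal :: "'a \<Rightarrow> 'a \<Rightarrow> 'a \<Rightarrow> 'a \<Rightarrow> bool" where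
  "rational_diagonal a b c d \<longleftrightarrow> (\<exists>z w. \<not> par z w \<and> B a b c d (fr z) w = 0 \<and> B a b c d (fr w) z = 0 \<and>
     \<not> par (G a b c d z) (G a b c d w))"

text \<open>The conditions on \<open>a', b', c', d'\<close> say that in the new coordinates \<open>y, y'\<close> the quadratic forms
  of both arguments are multiples of \<open>y y'\<close>; in characteristic 2 this leaves only \<open>b' = c' = 0\<close>
  and \<open>a' = d' = 0\<close>.\<close>
definition twisted_diagonal :: "'a \<Rightarrow> 'a \<Rightarrow> 'a \<Rightarrow> 'a \<Rightarrow> bool" where
  "twisted_diagonal a b c d \<longleftrightarrow> (\<exists>u v a' b' c' d'. u * bar u \<noteq> v * bar v \<and>
     (\<forall>w z. B a b c d (lin (fr u) (fr v) w) (lin u v z) = B a' b' c' d' w z) \<and>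
     a' * bar b' = c' * bar d' \<and> a' * bar c' = b' * bar d' \<and>
     a' * bar a' + b' * bar b' \<noteq> c' * bar c' + d' * bar d')"

lemma two_neq_0: "p \<noteq> 2 \<Longrightarrow> (2::'a) \<noteq> 0"
proof
  assume "p \<noteq> 2" "(2::'a) = 0"
  then have "of_nat 2 = (0::'a)"
    by simp
  then have "p dvd 2"
    using of_nat_eq_0_iff_char_dvd CHAR_eq by metis
  then show False
    using \<open>p \<noteq> 2\<close> prime_p primes_dvd_imp_eq two_is_prime_nat by blast
qed

lemma odd_p: "p \<noteq> 2 \<Longrightarrow> odd p"
  using prime_p primes_dvd_imp_eq two_is_prime_nat by blast

lemma proj_inj_root_imp_diagonal:
  assumes P: "proj_inj (G a b c d)" and "z \<noteq> 0" and R: "kernel_form a b c d z = 0"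
  shows "p = 2 \<and> rational_diagonal a b c d"
proof -
  define f where "f = (\<lambda>w. B a b c d w z)"
  define S N where "S = c * bar z + d * z" and "N = a * bar z + b * z"
  have f: "f w = lin S N w" for w
    by (simp add: f_def B_eq_lin S_def N_def)
  have SN: "S * bar S = N * bar N"
    using R by (simp add: kernel_form_def S_def N_def)
  \<comment> \<open>When the determinant vanishes, \<open>lin S N\<close> kills every element of the
    form \<open>N * bar t - bar S * t\<close>; a nonzero one of them provides the kernel vector
    \<open>fr w\<close>.\<close>
  have "\<exists>t. N * bar t - bar S * t \<noteq> 0"
  proof (rule ccontr)
    assume "\<not> ?thesis"
    then have "- bar S * t + N * bar t = 0" for t
      by simp
    from semilinear_eq_0[OF this] have "S = 0" "N = 0"
      by simp_all
    then have "f (fr z) = 0"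
      by (simp add: f lin_def)
    then show False
      using proj_inj_nonzero[OF P \<open>z \<noteq> 0\<close>] by (simp add: f_def G_def)
  qed
  then obtain t where t: "N * bar t - bar S * t \<noteq> 0"
    by blast
  have "f (N * bar t - bar S * t) = t * (N * bar N - S * bar S)"
    by (simp add: f lin_def algebra_simps)
  moreover obtain w where w: "fr w = N * bar t - bar S * t"
    using fr_surj by blast
  ultimately have fw: "B a b c d (fr w) z = 0"
    using SN by (simp add: f_def)
  have "w \<noteq> 0"
    using w t by auto
  define g0 g1 where "g0 = G a b c d z" and "g1 = G a b c d w"
  have nz: "g0 \<noteq> 0" "g1 \<noteq> 0"
    unfolding g0_def g1_def using P \<open>z \<noteq> 0\<close> \<open>w \<noteq> 0\<close> by (simp_all add: proj_inj_nonzero)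
  \<comment> \<open>The map \<open>f\<close> is linear over the subfield and kills
    \<open>fr w\<close> but not \<open>fr z\<close>.\<close>
  have nzw: "\<not> par z w"
  proof
    assume "par z w"
    from parE[OF this \<open>w \<noteq> 0\<close>] obtain t where t: "bar t = t" "z = t * w" .
    then have "bar (fr t) = fr t"
      by simp
    then have "B a b c d (fr z) z = fr t * B a b c d (fr w) z"
      unfolding t(2) by (simp add: B_def algebra_simps t(1))
    then show False
      using fw nz(1) by (simp add: g0_def G_def)
  qed
  then have ng: "\<not> par g0 g1"
    using proj_injD[OF P \<open>z \<noteq> 0\<close> \<open>w \<noteq> 0\<close>] unfolding g0_def g1_def by blast
  obtain x y where xy: "bar x = x" "bar y = y" "B a b c d (fr z) w = x * g0 + y * g1"
    by (rule not_par_span[OF ng])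
  have Gs: "G a b c d (s * z + t * w) = fr s * (s + t * x) * g0 + (fr s * t * y + fr t * t) * g1"
    if "bar s = s" "bar t = t" for s t
    unfolding G_combination[OF that] fw xy(3) g0_def[symmetric] g1_def[symmetric]
    by (simp add: algebra_simps)
  text \<open>If \<^term>\<open>y \<noteq> 0\<close> or \<^term>\<open>x \<noteq> 0\<close>, then the fibre through \<^term>\<open>z\<close> or \<^term>\<open>w\<close>, respectively,
    contains a further line.\<close>
  have "y = 0"
  proof (rule ccontr)
    assume "y \<noteq> 0"
    obtain t where t: "fr t = - y" "bar t = t"
      using fr_surj_fixed[of "- y"] xy by auto
    then have "t \<noteq> 0"
      using \<open>y \<noteq> 0\<close> by auto
    have "G a b c d (1 * z + t * w) = (1 + t * x) * g0"
      using Gs[of 1 t] t by (simp add: algebra_simps)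
    moreover have "bar (1 + t * x) = 1 + t * x"
      using t xy by simp
    ultimately have "par (G a b c d (1 * z + t * w)) g0"
      using par_mult_self by metis
    moreover have "1 * z + t * w \<noteq> 0"
      using combination_eq_0(1)[OF nzw, of 1 t] t by auto
    ultimately have "par (1 * z + t * w) (1 * z + 0 * w)"
      using proj_injD[OF P _ \<open>z \<noteq> 0\<close>] by (simp add: g0_def)
    then show False
      using par_combination_iff[OF nzw, of 1 t 1 0] t \<open>t \<noteq> 0\<close> by simp
  qed
  moreover have "x = 0"
  proof (rule ccontr)
    assume "x \<noteq> 0"
    have bx: "bar (- x) = - x"
      using xy by simp
    have "G a b c d (- x * z + 1 * w) = g1"
      using Gs[OF bx bar_1] \<open>y = 0\<close> by simp
    then have "par (G a b c d (- x * z + 1 * w)) (G a b c d w)"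
      by (simp add: g1_def)
    moreover have "- x * z + 1 * w \<noteq> 0"
      using combination_eq_0(2)[OF nzw bx bar_1] by auto
    ultimately have "par (- x * z + 1 * w) (0 * z + 1 * w)"
      using proj_injD[OF P _ \<open>w \<noteq> 0\<close>] by simp
    then show False
      unfolding par_combination_iff[OF nzw bx bar_1 bar_0 bar_1] using \<open>x \<noteq> 0\<close> by simp
  qed
  ultimately have fz: "B a b c d (fr z) w = 0"
    using xy by simp
  \<comment> \<open>Both mixed terms are gone, and \<open>fr t * t\<close> is unchanged when
    \<open>t\<close> changes sign. Hence the lines of \<open>z + w\<close> and \<open>z - w\<close>
    have the same image and must coincide.\<close>
  have "p = 2"
  proof (rule ccontr)
    assume "p \<noteq> 2"
    then have two: "(2::'a) \<noteq> 0" and "odd p"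
      using two_neq_0 odd_p by auto
    have m1: "bar (- 1) = - 1"
      by simp
    have eq: "G a b c d (1 * z + (- 1) * w) = G a b c d (1 * z + 1 * w)"
      using Gs[OF bar_1 bar_1] Gs[OF bar_1 m1] \<open>x = 0\<close> \<open>y = 0\<close> by simp
    have nz2: "1 * z + (- 1) * w \<noteq> 0" "1 * z + 1 * w \<noteq> 0"
      using combination_eq_0(1)[OF nzw bar_1 m1] combination_eq_0(1)[OF nzw bar_1 bar_1] by auto
    have "par (1 * z + (- 1) * w) (1 * z + 1 * w)"
      by (rule proj_injD[OF P nz2]) (simp only: eq par_refl)
    then have "1 * 1 = (- 1) * (1::'a)"
      unfolding par_combination_iff[OF nzw bar_1 m1 bar_1 bar_1] .
    then have "1 + 1 = (0::'a)"
      by (simp add: eq_neg_iff_add_eq_0)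
    then show False
      using two by simp
  qed
  moreover have "rational_diagonal a b c d"
    unfolding rational_diagonal_def using nzw fz fw ng[unfolded g0_def g1_def] by blast
  ultimately show ?thesis
    by blast
qed

section \<open>Power sums over the unit circle\<close>

lemma coprime_Q_q_plus_1: "coprime Q (q + 1)"
proof -
  have "p dvd q"
    using k_pos by (simp add: q_eq)
  then have "\<not> p dvd q + 1"
    using prime_p by (metis dvd_add_right_iff not_prime_unit)
  then have "coprime p (q + 1)"
    using prime_p prime_imp_coprime by blast
  then show ?thesis
    by (simp add: Q_eq)
qed

lemma unit_circle_eq: "{x. x * bar x = 1} = {x. x ^ (q + 1) = 1}"
  by (simp only: power_q_plus_1)

lemma card_unit_circle: "card {x. x * bar x = 1} = q + 1"
  unfolding unit_circle_eq by (rule roots_of_unity_finite_field(2)[OF card_minus_1_eq'])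

text \<open>Multiplication by \<open>y\<close> permutes the circle and multiplies the sum by
  \<open>y ^ n\<close>, so the sum vanishes unless all these factors are 1; in that case it counts
  \<open>q + 1\<close>, which is 1 in the field.\<close>

lemma sum_unit_circle_power:
  "(\<Sum>x | x * bar x = 1. x ^ n) = (if (q + 1) dvd n then 1 else 0)"
proof (cases "(q + 1) dvd n")
  case True
  then obtain j where "n = (q + 1) * j"
    by blast
  then have "x ^ n = 1" if "x * bar x = 1" for x
    by (simp only: \<open>n = (q + 1) * j\<close> power_mult power_q_plus_1 that power_one)
  then have "(\<Sum>x | x * bar x = 1. x ^ n) = of_nat (q + 1)"
    by (simp add: card_unit_circle[symmetric])
  moreover have "of_nat q = (0::'a)"
    using k_pos by (simp add: of_nat_eq_0_iff_char_dvd CHAR_eq q_eq)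
  ultimately show ?thesis
    using True by simp
next
  case False
  \<comment> \<open>Otherwise the whole circle would consist of roots of unity of exponent
    \<open>gcd n (q + 1)\<close>, a proper divisor of its size.\<close>
  have "\<exists>y. y * bar y = 1 \<and> y ^ n \<noteq> 1"
  proof (rule ccontr)
    assume "\<not> ?thesis"
    then have all: "y ^ n = 1" if "y ^ (q + 1) = 1" for y :: 'a
      using that unfolding power_q_plus_1 by blast
    have "n \<noteq> 0"
      using False by (metis dvd_0_right)
    define g where "g = gcd n (q + 1)"
    have "g dvd q + 1" "g dvd n"
      by (simp_all add: g_def)
    then have "g \<le> q + 1" "g \<noteq> q + 1"
      using False by (auto dest: dvd_imp_le)
    then have "g < q + 1"
      by simp
    have "g > 0"
      by (simp add: g_def)
    have "{y::'a. y ^ (q + 1) = 1} \<subseteq> {y. y ^ g = 1}"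
    proof
      fix y :: 'a assume y: "y \<in> {y. y ^ (q + 1) = 1}"
      obtain i j where "n * i = (q + 1) * j + g"
        using bezout_nat[OF \<open>n \<noteq> 0\<close>] unfolding g_def by blast
      then have "y ^ (n * i) = y ^ ((q + 1) * j) * y ^ g"
        by (simp only: power_add)
      then show "y \<in> {y. y ^ g = 1}"
        using y all[of y] unfolding power_mult by simp
    qed
    then have "card {y::'a. y ^ (q + 1) = 1} \<le> card {y::'a. y ^ g = 1}"
      by (intro card_mono) auto
    also have "\<dots> \<le> g"
      using \<open>g > 0\<close> by (rule card_roots_of_unity_le)
    finally show False
      using roots_of_unity_finite_field(2)[OF card_minus_1_eq'] \<open>g < q + 1\<close> by simp
  qed
  then obtain y where y: "y * bar y = 1" "y ^ n \<noteq> 1"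
    by blast
  then have "y \<noteq> 0"
    by auto
  have "(\<Sum>x | x * bar x = 1. x ^ n) = (\<Sum>x | x * bar x = 1. (y * x) ^ n)"
  proof (rule sum.reindex_bij_witness[of _ "\<lambda>x. y * x" "\<lambda>x. x / y"])
    fix x assume "x \<in> {x. x * bar x = 1}"
    then show "y * x \<in> {x. x * bar x = 1}" "x / y \<in> {x. x * bar x = 1}"
      using y by (simp_all add: mult.commute mult.left_commute)
  qed (use \<open>y \<noteq> 0\<close> in auto)
  also have "\<dots> = y ^ n * (\<Sum>x | x * bar x = 1. x ^ n)"
    by (simp add: power_mult_distrib sum_distrib_left)
  finally have "(1 - y ^ n) * (\<Sum>x | x * bar x = 1. x ^ n) = 0"
    by (simp add: algebra_simps)
  then show ?thesis
    using y False by simp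
qed

text \<open>As \<open>Q\<close> is invertible modulo \<open>q + 1\<close>, the numbers
  \<open>Q * i + 1\<close> with \<open>i\<close> up to \<open>q\<close> meet each residue
  once.\<close>

lemma ex1_index: "\<exists>!i. i \<le> q \<and> (q + 1) dvd Q * i + 1"
proof -
  obtain x where x: "[Q * x = 1] (mod (q + 1))"
    using cong_solve_coprime_nat[OF coprime_Q_q_plus_1] unfolding One_nat_def by blast
  \<comment> \<open>The factor \<open>q\<close> represents -1 modulo \<open>q + 1\<close>, so
    \<open>i\<close> is minus the inverse of \<open>Q\<close>.\<close>
  define i where "i = (x * q) mod (q + 1)"
  have "[Q * i = Q * (x * q)] (mod (q + 1))"
    unfolding i_def by (intro cong_mult) simp_all
  also have "[Q * (x * q) = 1 * q] (mod (q + 1))"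
    using cong_mult[OF x cong_refl[of q]] by (simp add: mult.assoc)
  finally have "[Q * i + 1 = 1 * q + 1] (mod (q + 1))"
    by (rule cong_add[OF _ cong_refl])
  then have "(q + 1) dvd Q * i + 1"
    by (metis cong_dvd_iff dvd_refl mult_1)
  moreover have "i \<le> q"
    unfolding i_def using mod_less_divisor[of "q + 1"] by (metis Suc_eq_plus1 less_Suc_eq_le zero_less_Suc)
  moreover have "j = j'" if "j \<le> q" "j' \<le> q" "(q + 1) dvd Q * j + 1" "(q + 1) dvd Q * j' + 1" for j j'
  proof -
    have "[Q * j + 1 = Q * j' + 1] (mod (q + 1))"
      using that by (simp add: cong_def mod_eq_0_iff_dvd del: mod_0_imp_dvd)
    then have "[Q * j = Q * j'] (mod (q + 1))"
      by (simp add: cong_add_rcancel_nat)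
    then have "[j = j'] (mod (q + 1))"
      using cong_mult_lcancel_nat[OF coprime_Q_q_plus_1] by blast
    then show ?thesis
      using that by (simp add: cong_less_modulus_unique_nat)
  qed
  ultimately show ?thesis
    by blast
qed

text \<open>The first power sum of the permutation of the unit circle induced by \<^term>\<open>G 0 b 0 d\<close>,
  with the denominator expanded as a finite geometric series, is a nonzero multiple
  of a power of \<^term>\<open>b / d\<close>.\<close>
lemma proj_inj_imp_monomial:
  assumes P: "proj_inj (G 0 b 0 d)"
  shows "b = 0 \<or> d = 0"
proof (rule ccontr)
  assume "\<not> ?thesis"
  then have "b \<noteq> 0" "d \<noteq> 0"
    by auto
  let ?M = "{x. x * bar x = 1}"
  have Gz: "G 0 b 0 d z = (b * fr (bar z) + d * fr z) * z" for z
    by (simp add: G_def B_def algebra_simps)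
  have nz: "b * x + d \<noteq> 0" if x: "x \<in> ?M" for x
  proof
    assume eq: "b * x + d = 0"
    obtain z where z: "z \<noteq> 0" "bar z = x * z"
      using norm_1_imp_quotient x by blast
    obtain w where w: "fr w = z"
      using fr_surj by blast
    have "G 0 b 0 d w = (b * bar (fr w) + d * fr w) * w"
      by (simp add: Gz)
    also have "\<dots> = (b * x + d) * z * w"
      by (simp add: w z algebra_simps)
    finally have "G 0 b 0 d w = 0"
      using eq by simp
    moreover have "w \<noteq> 0"
      using w z by auto
    ultimately show False
      using proj_inj_nonzero[OF P] by blast
  qed
  have norms: "b * bar b \<noteq> d * bar d"
  proof
    assume "b * bar b = d * bar d"
    then have "- d / b \<in> ?M"
      using \<open>b \<noteq> 0\<close> \<open>d \<noteq> 0\<close> by simp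
    from nz[OF this] show False
      using \<open>b \<noteq> 0\<close> by simp
  qed
  have frM: "fr x \<in> ?M" if "x \<in> ?M" for x
    using that by (metis (mono_tags) bar_fr fr_1 fr_mult mem_Collect_eq)
  \<comment> \<open>The self-map of the unit circle that \<open>G\<close> induces when a line is
    represented by \<open>bar z / z\<close>.\<close>
  define h where "h x = x * (bar b + bar d * fr x) / (b * fr x + d)" for x
  have hG: "h (bar z / z) = bar (G 0 b 0 d z) / G 0 b 0 d z" if "z \<noteq> 0" for z
  proof -
    have "h (bar z / z) = (bar z * ((bar b + bar d * fr (bar z / z)) * fr z))
        / (z * ((b * fr (bar z / z) + d) * fr z))"
      unfolding h_def using that by simp
    also have "(bar b + bar d * fr (bar z / z)) * fr z = bar b * fr z + bar d * fr (bar z)"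
      using that by (simp add: field_simps)
    also have "(b * fr (bar z / z) + d) * fr z = b * fr (bar z) + d * fr z"
      using that by (simp add: field_simps)
    finally show ?thesis
      unfolding Gz by (simp add: mult.commute)
  qed
  have M_quot: "\<exists>z. z \<noteq> 0 \<and> x = bar z / z" if "x \<in> ?M" for x
  proof -
    from that have "x * bar x = 1"
      by simp
    from norm_1_imp_quotient[OF this] obtain z where z: "z \<noteq> 0" "bar z = x * z" .
    then have "x = bar z / z"
      by (simp only: nonzero_mult_div_cancel_right not_False_eq_True)
    with z show ?thesis
      by blast
  qed
  have "h ` ?M \<subseteq> ?M"
  proof
    fix y assume "y \<in> h ` ?M"
    then obtain z where z: "z \<noteq> 0" "y = h (bar z / z)"
      using M_quot by blast
    then show "y \<in> ?M"
      using hG[OF z(1)] proj_inj_nonzero[OF P z(1)] by simp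
  qed
  moreover have "inj_on h ?M"
  proof (rule inj_onI)
    fix x y assume xy: "x \<in> ?M" "y \<in> ?M" "h x = h y"
    obtain z w where zw: "z \<noteq> 0" "x = bar z / z" "w \<noteq> 0" "y = bar w / w"
      using M_quot xy by metis
    then have "par (G 0 b 0 d z) (G 0 b 0 d w)"
      using xy(3) hG[OF zw(1)] hG[OF zw(3)] proj_inj_nonzero[OF P] by (simp add: par_def frac_eq_eq mult.commute)
    then have "par z w"
      using proj_injD[OF P] zw by blast
    then show "x = y"
      using zw by (simp add: par_def frac_eq_eq mult.commute)
  qed
  ultimately have bij: "bij_betw h ?M ?M"
    by (simp add: bij_betw_def endo_inj_surj)
  have sum1: "(\<Sum>x\<in>?M. x) = 0"
    using sum_unit_circle_power[of 1] q_gt_1 by simp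
  have "(\<Sum>x\<in>?M. h x) = (\<Sum>x\<in>?M. x)"
    by (rule sum.reindex_bij_betw[OF bij])
  then have sum_h: "(\<Sum>x\<in>?M. h x) = 0"
    using sum1 by simp
  \<comment> \<open>Remainder of the numerator of \<open>h\<close> on division by its denominator,
    as polynomials in \<open>fr x\<close>; it is nonzero because the norms of \<open>b\<close> and
    \<open>d\<close> differ.\<close>
  define r where "r = bar b - d * bar d / b"
  have "r \<noteq> 0"
    using norms \<open>b \<noteq> 0\<close> by (auto simp: r_def field_simps)
  have "h x = bar d / b * x + r * (x / (b * fr x + d))" if "x \<in> ?M" for x
  proof -
    have num: "bar b + bar d * y = bar d / b * (b * y + d) + r" for y
      using \<open>b \<noteq> 0\<close> by (simp add: r_def field_simps)
    have "x * (c * y + r) / y = c * x + r * (x / y)" if "y \<noteq> 0" for c y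
      using that by (simp add: field_simps)
    from this[OF nz[OF frM[OF that]]] show ?thesis
      by (simp only: h_def num)
  qed
  then have "(\<Sum>x\<in>?M. h x) = bar d / b * (\<Sum>x\<in>?M. x) + r * (\<Sum>x\<in>?M. x / (b * fr x + d))"
    by (simp add: sum.distrib sum_distrib_left)
  then have sum2: "(\<Sum>x\<in>?M. x / (b * fr x + d)) = 0"
    using sum_h sum1 \<open>r \<noteq> 0\<close> by simp
  define t where "t = - b / d"
  have t: "t \<noteq> 0" "t * bar t \<noteq> 1"
    using \<open>b \<noteq> 0\<close> \<open>d \<noteq> 0\<close> norms by (simp_all add: t_def)
  \<comment> \<open>The geometric series closes up after \<open>q + 1\<close> terms because the
    power of \<open>t * fr x\<close> with exponent \<open>q + 1\<close> is its norm, which is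
    \<open>t * bar t\<close> on the whole circle.\<close>
  have geom: "x / (b * fr x + d) = (\<Sum>i\<le>q. t ^ i * x ^ (Q * i + 1)) / (d * (1 - t * bar t))"
    if "x \<in> ?M" for x
  proof -
    have "(t * fr x) ^ (q + 1) = t * bar t * (fr x * bar (fr x))"
      unfolding power_q_plus_1 by (simp add: mult_ac)
    also have "fr x * bar (fr x) = 1"
      using frM[OF that] by simp
    finally have "(t * fr x) ^ (q + 1) = t * bar t"
      by simp
    moreover have "{..<q + 1} = {..q}"
      by auto
    ultimately have "(1 - t * fr x) * (\<Sum>i\<le>q. (t * fr x) ^ i) = 1 - t * bar t"
      using one_diff_power_eq[of "t * fr x" "q + 1"] by (simp only:)
    then have "d * (1 - t * fr x) * (\<Sum>i\<le>q. (t * fr x) ^ i) = d * (1 - t * bar t)"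
      by (simp only: mult.assoc)
    moreover have "d * (1 - t * fr x) = b * fr x + d"
      using \<open>d \<noteq> 0\<close> by (simp add: t_def field_simps)
    ultimately have "(b * fr x + d) * (\<Sum>i\<le>q. (t * fr x) ^ i) = d * (1 - t * bar t)"
      by simp
    then have "1 / (b * fr x + d) = (\<Sum>i\<le>q. (t * fr x) ^ i) / (d * (1 - t * bar t))"
      using nz[OF frM[OF that]] t \<open>d \<noteq> 0\<close> by (simp add: frac_eq_eq mult.commute)
    then have "x / (b * fr x + d) = (x * (\<Sum>i\<le>q. (t * fr x) ^ i)) / (d * (1 - t * bar t))"
      by (metis mult.right_neutral times_divide_eq_right)
    also have "x * (\<Sum>i\<le>q. (t * fr x) ^ i) = (\<Sum>i\<le>q. t ^ i * x ^ (Q * i + 1))"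
    proof -
      have "x ^ (Q * i + 1) = x * fr x ^ i" for i
        by (simp add: fr_eq power_add power_mult)
      then show ?thesis
        by (simp add: sum_distrib_left power_mult_distrib mult.left_commute)
    qed
    finally show ?thesis .
  qed
  have "(\<Sum>x\<in>?M. x / (b * fr x + d))
      = (\<Sum>x\<in>?M. \<Sum>i\<le>q. t ^ i * x ^ (Q * i + 1)) / (d * (1 - t * bar t))"
    by (simp add: geom sum_divide_distrib)
  then have "(\<Sum>x\<in>?M. \<Sum>i\<le>q. t ^ i * x ^ (Q * i + 1)) = 0"
    using sum2 t \<open>d \<noteq> 0\<close> by simp
  then have "(\<Sum>i\<le>q. t ^ i * (\<Sum>x\<in>?M. x ^ (Q * i + 1))) = 0"
    by (subst (asm) sum.swap) (simp only: sum_distrib_left)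
  then have 0: "(\<Sum>i\<le>q. if (q + 1) dvd Q * i + 1 then t ^ i else 0) = 0"
    by (simp add: sum_unit_circle_power if_distrib cong: if_cong)
  obtain i0 where i0: "i0 \<le> q" "(q + 1) dvd Q * i0 + 1"
    "\<And>i. i \<le> q \<Longrightarrow> (q + 1) dvd Q * i + 1 \<Longrightarrow> i = i0"
    using ex1_index by blast
  have "(\<Sum>i\<le>q. if (q + 1) dvd Q * i + 1 then t ^ i else 0) = (\<Sum>i\<le>q. if i = i0 then t ^ i else 0)"
  proof (rule sum.cong)
    fix i assume "i \<in> {..q}"
    then have "(q + 1) dvd Q * i + 1 \<longleftrightarrow> i = i0"
      using i0 by blast
    then show "(if (q + 1) dvd Q * i + 1 then t ^ i else 0) = (if i = i0 then t ^ i else 0)"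
      by (simp only:)
  qed simp
  also have "\<dots> = t ^ i0"
    using i0(1) by simp
  finally show False
    using 0 t by simp
qed

lemma proj_inj_anisotropic:
  assumes P: "proj_inj (G a b c d)" and R: "\<And>z. z \<noteq> 0 \<Longrightarrow> kernel_form a b c d z \<noteq> 0"
  shows "p = 2 \<and> twisted_diagonal a b c d"
proof -
  define s e where "s = c * bar d - a * bar b" and "e = c * bar c + d * bar d - a * bar a - b * bar b"
  have kernel_form: "kernel_form a b c d z = s * (bar z * bar z) + e * (z * bar z) + bar s * (z * z)" for z
    unfolding s_def e_def by (rule kernel_form_eq)
  have be: "bar e = e"
    by (simp add: e_def mult.commute)
  \<comment> \<open>The substitution is chosen to remove the square terms of \<open>R\<close>: for a
    root \<open>x\<close> take \<open>bar u = x\<close> and \<open>v = 1\<close>. It is invertible,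
    since by Hilbert 90 a root of norm 1 would yield a zero of \<open>R\<close>.\<close>
  have "\<exists>u v. u * bar u \<noteq> v * bar v \<and> s * (bar u * bar u) + e * (bar u * v) + bar s * (v * v) = 0"
  proof (cases "s = 0")
    case True
    then show ?thesis
      by (intro exI[of _ 1] exI[of _ 0]) simp
  next
    case False
    have "bar (s * bar s) = s * bar s"
      by (simp add: mult.commute)
    from quadratic_has_root[OF be this] obtain y where y: "y * y + e * y + s * bar s = 0"
      by blast
    define x where "x = y / s"
    have "s * (s * (x * x) + e * x + bar s) = y * y + e * y + s * bar s"
      using False by (simp add: x_def field_simps)
    then have x: "s * (x * x) + e * x + bar s = 0"
      using y False by simp
    have "x * bar x \<noteq> 1"
    proof
      assume "x * bar x = 1"
      then obtain z where z: "z \<noteq> 0" "bar z = x * z"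
        using norm_1_imp_quotient by blast
      then have "kernel_form a b c d z = (s * (x * x) + e * x + bar s) * (z * z)"
        by (simp add: kernel_form algebra_simps)
      then show False
        using R[OF z(1)] x by simp
    qed
    then show ?thesis
      using x by (intro exI[of _ "bar x"] exI[of _ 1]) (simp add: mult.commute)
  qed
  then obtain u v where uv: "u * bar u \<noteq> v * bar v"
    and root: "s * (bar u * bar u) + e * (bar u * v) + bar s * (v * v) = 0"
    by blast
  define a' where "a' = a * fr (bar u) * bar u + b * fr (bar u) * v + c * fr v * bar u + d * fr v * v"
  define b' where "b' = a * fr (bar u) * bar v + b * fr (bar u) * u + c * fr v * bar v + d * fr v * u"
  define c' where "c' = a * fr (bar v) * bar u + b * fr (bar v) * v + c * fr u * bar u + d * fr u * v"
  define d' where "d' = a * fr (bar v) * bar v + b * fr (bar v) * u + c * fr u * bar v + d * fr u * u"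
  have B': "B a b c d (lin (fr u) (fr v) w) (lin u v z) = B a' b' c' d' w z" for w z
    unfolding a'_def b'_def c'_def d'_def by (rule B_lin)
  have G': "G a' b' c' d' = (\<lambda>z. G a b c d (lin u v z))"
    by (simp add: fun_eq_iff G_def fr_lin B')
  have P': "proj_inj (G a' b' c' d')"
    unfolding G' using P proj_inj_comp_lin[OF uv, of "G a b c d"] by simp
  have "c' * bar d' - a' * bar b'
      = fr (u * bar u - v * bar v) * (s * (bar u * bar u) + e * (bar u * v) + bar s * (v * v))"
    by (simp add: a'_def b'_def c'_def d'_def s_def e_def algebra_simps)
  then have s': "a' * bar b' = c' * bar d'"
    using root by simp
  have "kernel_form a' b' c' d' 1 = fr (u * bar u - v * bar v) * kernel_form a b c d (lin u v 1)"
    by (simp add: a'_def b'_def c'_def d'_def kernel_form_def lin_def algebra_simps)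
  moreover have "lin u v 1 \<noteq> 0"
    using lin_eq_0_iff[OF uv] by simp
  moreover have "fr (u * bar u - v * bar v) \<noteq> 0"
    using uv by (simp only: fr_eq_0_iff right_minus_eq) simp
  ultimately have "kernel_form a' b' c' d' 1 \<noteq> 0"
    using R by (simp only: mult_eq_0_iff) simp
  then have e': "a' * bar a' + b' * bar b' \<noteq> c' * bar c' + d' * bar d'"
    unfolding kernel_form_eq using s' by (auto simp: algebra_simps)
  \<comment> \<open>A change of target that removes the first and third coefficient. By
    \<open>s'\<close> the two equations are proportional, and \<open>e'\<close> ensures that one of
    the two obvious solutions is invertible.\<close>
  have "\<exists>U V. U * bar U \<noteq> V * bar V \<and> U * a' + V * bar d' = 0 \<and> U * c' + V * bar b' = 0"
  proof (cases "d' * bar d' = a' * bar a'")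
    case False
    then show ?thesis
      using s' by (intro exI[of _ "bar d'"] exI[of _ "- a'"]) (simp add: mult.commute)
  next
    case True
    then have "b' * bar b' \<noteq> c' * bar c'"
      using e' by auto
    then show ?thesis
      using s' by (intro exI[of _ "bar b'"] exI[of _ "- c'"]) (simp add: mult.commute)
  qed
  then obtain U V where UV: "U * bar U \<noteq> V * bar V"
    and ac: "U * a' + V * bar d' = 0" "U * c' + V * bar b' = 0"
    by blast
  define b'' d'' where "b'' = U * b' + V * bar c'" and "d'' = U * d' + V * bar a'"
  have "lin U V (B a' b' c' d' w z) = B (U * a' + V * bar d') b'' (U * c' + V * bar b') d'' w z" for w z
    unfolding b''_def d''_def by (simp add: B_def lin_def algebra_simps)
  then have B'': "lin U V (B a' b' c' d' w z) = B 0 b'' 0 d'' w z" for w z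
    by (simp only: ac)
  have "G 0 b'' 0 d'' = (\<lambda>z. lin U V (G a' b' c' d' z))"
    by (simp add: fun_eq_iff G_def B'')
  then have P'': "proj_inj (G 0 b'' 0 d'')"
    using P' proj_inj_lin_comp[OF UV] by simp
  then have bd: "b'' = 0 \<or> d'' = 0"
    by (rule proj_inj_imp_monomial)
  \<comment> \<open>A target change multiplies the expression \<open>b * bar d - a * bar c\<close>
    by its determinant, so the vanishing for the monomial form carries back to the primed
    coefficients.\<close>
  have "b'' * bar d'' - (U * a' + V * bar d') * bar (U * c' + V * bar b')
      = (U * bar U - V * bar V) * (b' * bar d' - a' * bar c')"
    by (simp add: b''_def d''_def algebra_simps)
  then have t': "a' * bar c' = b' * bar d'"
    using bd UV ac by auto
  have "p = 2"
  proof (rule ccontr)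
    assume "p \<noteq> 2"
    then have odd: "odd q" "odd Q"
      using odd_p by (simp_all add: q_eq Q_eq)
    \<comment> \<open>For odd \<open>p\<close> each possible exponent shares the factor 2 with
      \<open>q + 1\<close>.\<close>
    have "\<not> coprime (Q + 1) (q + 1)" "\<not> coprime (Q + q) (q + 1)"
      using odd coprime_common_divisor[of "Q + 1" "q + 1" 2]
        coprime_common_divisor[of "Q + q" "q + 1" 2] by auto
    then have np: "\<not> proj_inj (\<lambda>z. z ^ (Q + 1))" "\<not> proj_inj (\<lambda>z. z ^ (Q + q))"
      unfolding proj_inj_power_iff by blast+
    from bd show False
    proof
      assume "b'' = 0"
      then have G: "G 0 b'' 0 d'' = (\<lambda>z. lin d'' 0 (z ^ (Q + 1)))"
        by (simp add: fun_eq_iff G_def B_def lin_def fr_eq power_add)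
      then have "d'' \<noteq> 0"
        using proj_inj_nonzero[OF P'', of 1] by (auto simp: lin_def)
      then show False
        using np P'' unfolding G by (simp add: proj_inj_lin_comp)
    next
      assume "d'' = 0"
      then have G: "G 0 b'' 0 d'' = (\<lambda>z. lin 0 b'' (z ^ (Q + q)))"
        by (simp add: fun_eq_iff G_def B_def lin_def fr_eq power_add flip: bar_eq)
      then have "b'' \<noteq> 0"
        using proj_inj_nonzero[OF P'', of 1] by (auto simp: lin_def)
      then show False
        using np P'' unfolding G by (simp add: proj_inj_lin_comp)
    qed
  qed
  moreover have "twisted_diagonal a b c d"
    unfolding twisted_diagonal_def using uv B' s' t' e' by blast
  ultimately show ?thesis
    by blast
qed

lemma proj_inj_imp_diagonal:
  assumes "proj_inj (G a b c d)"
  shows "p = 2 \<and> (rational_diagonal a b c d \<or> twisted_diagonal a b c d)"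
  using proj_inj_root_imp_diagonal[OF assms] proj_inj_anisotropic[OF assms] by blast

text \<open>With determinant zero the image lies in a single line.\<close>

lemma par_lin:
  assumes "u * bar u = v * bar v"
  shows "par (lin u v z) (lin u v w)"
proof -
  have "lin u v z * bar (lin u v w) - bar (lin u v z) * lin u v w
      = (u * bar u - v * bar v) * (z * bar w - bar z * w)"
    by (simp add: lin_def algebra_simps)
  then show ?thesis
    using assms by (simp add: par_def)
qed

lemma par_fr_iff: "par (fr z) (fr w) \<longleftrightarrow> par z w"
proof -
  have "par (fr z) (fr w) \<longleftrightarrow> fr (z * bar w) = fr (bar z * w)"
    by (simp add: par_def)
  then show ?thesis
    unfolding fr_eq_iff par_def .
qed

text \<open>Intended for the values of \<open>B\<close> on a basis. If a diagonal and an
  off-diagonal entry were both nonzero, parallelism along rows and columns would put all four on one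
  line, against \<open>np\<close>.\<close>

lemma par_matrix_cases:
  assumes "par h11 h21" "par h12 h22" "par h11 h12" "par h21 h22"
    and np: "\<not> par (h11 + h12) (h21 + h22)"
  shows "h12 = 0 \<and> h21 = 0 \<and> \<not> par h11 h22 \<or> h11 = 0 \<and> h22 = 0"
proof (cases "h11 = 0")
  case True
  have "h22 = 0"
  proof (rule ccontr)
    assume nz: "h22 \<noteq> 0"
    from parE[OF assms(2) nz] obtain x where x: "bar x = x" "h12 = x * h22" .
    from parE[OF assms(4) nz] obtain y where y: "bar y = y" "h21 = y * h22" .
    show False
      using np True x y by (simp add: par_def algebra_simps)
  qed
  then show ?thesis
    using True by simp
next
  case False
  from parE[OF iffD1[OF par_sym assms(3)] False] obtain x where x: "bar x = x" "h12 = x * h11" .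
  from parE[OF iffD1[OF par_sym assms(1)] False] obtain y where y: "bar y = y" "h21 = y * h11" .
  have "par h22 h11" if "h12 \<noteq> 0 \<or> h21 \<noteq> 0"
    using that par_trans[of h22 h12 h11] par_trans[of h22 h21 h11] assms by (auto simp: par_sym)
  then have "\<exists>r. bar r = r \<and> h22 = r * h11" if "h12 \<noteq> 0 \<or> h21 \<noteq> 0"
    using that parE[OF _ False] by metis
  moreover have "\<nexists>r. bar r = r \<and> h22 = r * h11"
    using np x y by (auto simp: par_def algebra_simps)
  ultimately have "h12 = 0" "h21 = 0"
    by blast+
  then show ?thesis
    using np by simp
qed

end

subsection \<open>Characteristic 2\<close>

locale frobenius_pair_2 = frobenius_pair p k q bar l Q fr
  for p k q :: nat and bar :: "'a::finite_field \<Rightarrow> 'a" and l Q fr +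
  fixes m K L :: nat
  assumes p_eq_2: "p = 2" and k_eq: "k = m * K" and l_eq: "l = m * L"
    and parity: "odd K \<or> odd L"
begin

lemma add_self [simp]: "x + x = (0::'a)"
proof -
  have "of_nat 2 = (0::'a)"
    using of_nat_CHAR[where ?'a = 'a] by (simp only: CHAR_eq p_eq_2)
  then have "x * of_nat 2 = 0"
    by simp
  then show ?thesis
    by (simp add: mult_2_right)
qed

lemma add_self_left [simp]: "x + (x + y) = (y::'a)"
  by (simp flip: add.assoc)

lemma minus_eq [simp]: "- x = (x::'a)"
  using add_self[of x] by (simp only: eq_neg_iff_add_eq_0 [symmetric])

lemma diff_eq [simp]: "x - y = x + (y::'a)"
  by (simp only: diff_conv_add_uminus minus_eq)

lemma add_eq_0_iff [simp]: "x + y = 0 \<longleftrightarrow> x = (y::'a)"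
  by (metis add_self add_self_left add.right_neutral)

lemma of_nat_eq: "of_nat n = (if even n then 0 else 1 :: 'a)"
  by (induction n) auto

lemma m_pos: "m > 0" and K_pos: "K > 0"
  using k_pos k_eq by simp_all

lemma q_eq_power: "q = (2 ^ m) ^ K" and Q_eq_power: "Q = (2 ^ m) ^ L"
  by (simp_all add: q_eq Q_eq k_eq l_eq p_eq_2 power_mult)

lemma coprime_iff_parity:
  "coprime (Q + 1) (q + 1) \<longleftrightarrow> even K \<or> even L"
  "coprime (Q + q) (q + 1) \<longleftrightarrow> odd L"
  "coprime (Q + 1) (q - 1) \<longleftrightarrow> odd K"
proof -
  let ?s = "2 ^ m :: int"
  have s: "even ?s" "?s > 0"
    using m_pos by simp_all
  have int_q: "int q = ?s ^ K" and int_Q: "int Q = ?s ^ L"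
    by (simp_all add: q_eq_power Q_eq_power)
  have co: "coprime x y \<longleftrightarrow> coprime (int x) (int y)" for x y :: nat
    by simp
  show "coprime (Q + 1) (q + 1) \<longleftrightarrow> even K \<or> even L"
    using coprime_power_plus_1_iff(1)[OF s K_pos parity]
    unfolding co of_nat_add of_nat_1 int_q int_Q .
  \<comment> \<open>Modulo \<open>q + 1\<close> the exponent \<open>Q + q\<close> reduces to
    \<open>Q - 1\<close>.\<close>
  have "int (Q + q) = (?s ^ L - 1) + (?s ^ K + 1)" "int (q + 1) = ?s ^ K + 1"
    by (simp_all add: int_q int_Q)
  then have "coprime (Q + q) (q + 1) \<longleftrightarrow> coprime (?s ^ L - 1) (?s ^ K + 1)"
    unfolding co coprime_iff_gcd_eq_1 by (simp only: gcd_add1)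
  then show "coprime (Q + q) (q + 1) \<longleftrightarrow> odd L"
    using coprime_power_plus_1_iff(2)[OF s K_pos parity] by simp
  show "coprime (Q + 1) (q - 1) \<longleftrightarrow> odd K"
  \<comment> \<open>The coprimality criterion is applied with \<open>K\<close> and \<open>L\<close>
    exchanged, which requires positive \<open>L\<close>. For \<open>L = 0\<close> the numbers are 2
    and an odd number.\<close>
  proof (cases "L = 0")
    case True
    then have "odd K"
      using parity by simp
    moreover have "Q = 1"
      using True by (simp add: Q_eq_power)
    moreover have "odd (q - 1)"
      using q_gt_1 m_pos K_pos by (simp add: q_eq_power)
    ultimately show ?thesis
      by (simp add: coprime_commute)
  next
    case False
    have "int (q - 1) = ?s ^ K - 1"
      using q_gt_1 int_q by (simp add: of_nat_diff)
    then have "coprime (Q + 1) (q - 1) \<longleftrightarrow> coprime (?s ^ K - 1) (?s ^ L + 1)"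
      unfolding co by (simp add: int_Q coprime_commute)
    then show ?thesis
      using coprime_power_plus_1_iff(2)[OF s, of L K] False parity by auto
  qed
qed

section \<open>The trace to the field with \<open>2 ^ m\<close> elements\<close>

abbreviation T :: "'a \<Rightarrow> 'a" where
  "T \<equiv> trace_map (2 ^ m) K"

lemma power_s_add: "(x + y) ^ (2 ^ m) = x ^ (2 ^ m) + (y::'a) ^ (2 ^ m)"
  by (rule freshmans_dream'[where n = m]) (simp_all add: CHAR_eq p_eq_2)

lemma T_add: "T (x + y) = T x + T y"
proof -
  have "(x + y) ^ ((2 ^ m) ^ i) = x ^ ((2 ^ m) ^ i) + y ^ ((2 ^ m) ^ i)" for i
    by (rule freshmans_dream'[where n = "m * i"]) (simp_all add: CHAR_eq p_eq_2 power_mult)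
  then show ?thesis
    by (simp add: trace_map_def sum.distrib)
qed

lemma T_1: "T 1 = of_nat K"
  by (simp add: trace_map_def)

lemma T_fr: "T (fr x) = fr (T x)"
proof -
  have "fr (\<Sum>i\<in>A. f i) = (\<Sum>i\<in>A. fr (f i))" for f and A :: "nat set"
    by (induction A rule: infinite_finite_induct) simp_all
  then show ?thesis
    by (simp add: trace_map_def fr_eq mult.commute flip: power_mult)
qed

text \<open>Telescoping: the power with exponent \<open>2 ^ m\<close> shifts the summands of
  \<open>T x\<close> by one place.\<close>

lemma T_power_s: "T x ^ (2 ^ m) + T x = bar x + x"
proof -
  have "trace_map (2 ^ m) n x ^ (2 ^ m) + trace_map (2 ^ m) n x = x ^ ((2 ^ m) ^ n) + x" for n
  proof (induction n)
    case 0
    then show ?case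
      using m_pos by (simp add: trace_map_def zero_power)
  next
    case (Suc n)
    have "trace_map (2 ^ m) (Suc n) x = trace_map (2 ^ m) n x + x ^ ((2 ^ m) ^ n)"
      by (simp add: trace_map_def)
    then have "trace_map (2 ^ m) (Suc n) x ^ (2 ^ m) + trace_map (2 ^ m) (Suc n) x
        = (trace_map (2 ^ m) n x ^ (2 ^ m) + trace_map (2 ^ m) n x)
          + (x ^ ((2 ^ m) ^ n)) ^ (2 ^ m) + x ^ ((2 ^ m) ^ n)"
      by (simp only: power_s_add add_ac)
    also have "\<dots> = (x ^ ((2 ^ m) ^ n)) ^ (2 ^ m) + x"
      unfolding Suc.IH by (simp add: add_ac)
    finally show ?case
      by (simp add: mult.commute flip: power_mult)
  qed
  then show ?thesis
    by (simp add: bar_eq q_eq_power)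
qed

text \<open>Here \<open>v\<close> may lie outside the subfield. By \<open>T_power_s\<close>, each
  power with exponent \<open>2 ^ m\<close> adds \<open>t\<close> to \<open>T v\<close>, and
  \<open>fr\<close> consists of \<open>L\<close> such powers.\<close>

lemma T_fr_plus_self:
  assumes "bar v + v = t" "t ^ (2 ^ m) = t"
  shows "T (fr v + v) = of_nat L * t"
proof -
  have step: "T v ^ (2 ^ m) = T v + t"
    using T_power_s[of v] assms(1) by (metis add.commute add_self_left)
  have "T v ^ ((2 ^ m) ^ n) = T v + of_nat n * t" for n
  proof (induction n)
    case (Suc n)
    have n: "(of_nat n * t) ^ (2 ^ m) = of_nat n * t"
      using assms(2) m_pos by (simp add: of_nat_eq zero_power)
    have "T v ^ ((2 ^ m) ^ Suc n) = (T v ^ ((2 ^ m) ^ n)) ^ (2 ^ m)"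
      by (simp add: mult.commute flip: power_mult)
    also have "\<dots> = T v + of_nat (Suc n) * t"
      by (simp only: Suc.IH power_s_add step n) (simp add: algebra_simps)
    finally show ?case .
  qed simp
  then have "fr (T v) = T v + of_nat L * t"
    by (simp add: fr_eq Q_eq_power)
  then show ?thesis
    by (simp add: T_add T_fr add_ac)
qed

text \<open>In characteristic 2, the elements \<open>z\<close> for which \<open>B(-, z)\<close> and \<open>B(z, -)\<close> are singular are
  the zeros of \<open>s z'\<^sup>2 + e z z' + s' z\<^sup>2\<close> and \<open>t z'\<^sup>2 + e z z' + t' z\<^sup>2\<close>, respectively.\<close>
definition e_coeff :: "'a \<Rightarrow> 'a \<Rightarrow> 'a \<Rightarrow> 'a \<Rightarrow> 'a" where
  "e_coeff a b c d = a * bar a + b * bar b + c * bar c + d * bar d"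

definition s_coeff :: "'a \<Rightarrow> 'a \<Rightarrow> 'a \<Rightarrow> 'a \<Rightarrow> 'a" where
  "s_coeff a b c d = a * bar b + c * bar d"

definition t_coeff :: "'a \<Rightarrow> 'a \<Rightarrow> 'a \<Rightarrow> 'a \<Rightarrow> 'a" where
  "t_coeff a b c d = a * bar c + b * bar d"

text \<open>Condition (5) with \<open>K * L\<close> instead of \<open>lcm k l div m\<close>; the two
  have the same parity, which is all that the field sees.\<close>

definition trace_cond :: "'a \<Rightarrow> 'a \<Rightarrow> 'a \<Rightarrow> 'a \<Rightarrow> bool" where
  "trace_cond a b c d \<longleftrightarrow> T ((b * bar b + c * bar c) / e_coeff a b c d) = of_nat (K * L)"

section \<open>Invariants and traces of the normal forms\<close>

lemma diagonal_identities:
  assumes "a = a' * fr (bar u) * bar u + d' * fr v * v"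
    and "b = a' * fr (bar u) * bar v + d' * fr v * u"
    and "c = a' * fr (bar v) * bar u + d' * fr u * v"
    and "d = a' * fr (bar v) * bar v + d' * fr u * u"
    and D: "D = u * bar u + v * bar v" and E: "E = a' * bar a' + d' * bar d'"
  shows "e_coeff a b c d = E * (fr D * D)"
    and "s_coeff a b c d = E * (bar u * v) * fr D"
    and "t_coeff a b c d = E * fr (bar u * v) * D"
    and "b * bar b + c * bar c = E * (fr (u * bar u) * (v * bar v) + fr (v * bar v) * (u * bar u))"
  by (simp_all add: e_coeff_def s_coeff_def t_coeff_def assms(1-4) D E algebra_simps)

text \<open>The coefficients are those of \<open>B_lin\<close> for a form with only
  \<open>b'\<close> and \<open>c'\<close>, just as the diagonal case starts from \<open>a'\<close>
  and \<open>d'\<close>. The numerator computed here is the complementary one of (5).\<close>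

lemma antidiagonal_identities:
  assumes "a = b' * fr (bar u) * v + c' * fr v * bar u"
    and "b = b' * fr (bar u) * u + c' * fr v * bar v"
    and "c = b' * fr (bar v) * v + c' * fr u * bar u"
    and "d = b' * fr (bar v) * u + c' * fr u * bar v"
    and D: "D = u * bar u + v * bar v" and E: "E = b' * bar b' + c' * bar c'"
  shows "e_coeff a b c d = E * (fr D * D)"
    and "s_coeff a b c d = E * (bar u * v) * fr D"
    and "t_coeff a b c d = E * fr (bar u * v) * D"
    and "a * bar a + d * bar d = E * (fr (u * bar u) * (v * bar v) + fr (v * bar v) * (u * bar u))"
  by (simp_all add: e_coeff_def s_coeff_def t_coeff_def assms(1-4) D E algebra_simps)

text \<open>The coefficients are those of \<open>coeffs_from_basis\<close> with vanishing mixed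
  values, where \<open>g\<close> and \<open>h\<close> are the values of \<open>G\<close> at
  \<open>z\<close> and \<open>w\<close> divided by \<open>fr D * D\<close>.\<close>

lemma rational_identities:
  assumes "a = g * fr w * w + h * fr z * z"
    and "b = g * fr w * bar w + h * fr z * bar z"
    and "c = g * fr (bar w) * w + h * fr (bar z) * z"
    and "d = g * fr (bar w) * bar w + h * fr (bar z) * bar z"
    and D: "D = z * bar w + bar z * w" and E: "E = g * bar h + bar g * h"
  shows "e_coeff a b c d = E * (fr D * D)"
    and "s_coeff a b c d = E * (w * z) * fr D"
    and "t_coeff a b c d = E * fr (w * z) * D"
    and "b * bar b + c * bar c
      = E * (fr (w * bar z) * (bar w * z) + fr (bar w * z) * (w * bar z))"
  by (simp_all add: e_coeff_def s_coeff_def t_coeff_def assms(1-4) D E algebra_simps)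

lemma rational_mixed_identities:
  assumes "a = g * fr w * z + h * fr z * w"
    and "b = g * fr w * bar z + h * fr z * bar w"
    and "c = g * fr (bar w) * z + h * fr (bar z) * w"
    and "d = g * fr (bar w) * bar z + h * fr (bar z) * bar w"
    and D: "D = z * bar w + bar z * w" and E: "E = g * bar h + bar g * h"
  shows "e_coeff a b c d = E * (fr D * D)"
    and "a * bar a + d * bar d
      = E * (fr (w * bar z) * (bar w * z) + fr (bar w * z) * (w * bar z))"
  by (simp_all add: e_coeff_def assms(1-4) D E algebra_simps)

text \<open>Cramer's rule in both arguments recovers a bilinear map from its values on a basis:
  \<open>D\<close> is the determinant for the second argument and \<open>fr D\<close> that for the
  first.\<close>

lemma coeffs_from_basis:
  fixes a b c d z w
  defines "D \<equiv> z * bar w + bar z * w"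
    and "g1 \<equiv> B a b c d (fr z) z" and "g2 \<equiv> B a b c d (fr z) w"
    and "g3 \<equiv> B a b c d (fr w) z" and "g4 \<equiv> B a b c d (fr w) w"
  shows "a * (fr D * D) = g1 * fr w * w + g2 * fr w * z + g3 * fr z * w + g4 * fr z * z"
    and "b * (fr D * D) = g1 * fr w * bar w + g2 * fr w * bar z + g3 * fr z * bar w + g4 * fr z * bar z"
    and "c * (fr D * D) = g1 * fr (bar w) * w + g2 * fr (bar w) * z + g3 * fr (bar z) * w + g4 * fr (bar z) * z"
    and "d * (fr D * D) = g1 * fr (bar w) * bar w + g2 * fr (bar w) * bar z + g3 * fr (bar z) * bar w + g4 * fr (bar z) * bar z"
  by (simp_all add: D_def g1_def g2_def g3_def g4_def B_def algebra_simps)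

text \<open>With \<open>v = y / D\<close> the quotient \<open>N / e\<close> equals
  \<open>fr v + v\<close>, and \<open>bar v + v\<close> is 0 or 1 according to whether conjugation
  fixes or exchanges \<open>y\<close> and \<open>y'\<close>.\<close>

lemma trace_ratio:
  assumes "E \<noteq> 0" and D: "D = y + y'" "D \<noteq> 0"
    and N: "N = E * (fr y * y' + fr y' * y)" and e: "e = E * (fr D * D)"
  shows "bar y = y \<Longrightarrow> bar y' = y' \<Longrightarrow> T (N / e) = 0"
    and "bar y = y' \<Longrightarrow> T (N / e) = of_nat L"
proof -
  define v where "v = y / D"
  have "E * (fr D * D) * (fr v + v) = E * (fr y * D + y * fr D)"
    using D(2) by (simp add: v_def field_simps)
  also have "\<dots> = N"
    by (simp add: N D(1) algebra_simps)
  finally have "N / e = fr v + v"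
    using \<open>E \<noteq> 0\<close> D(2) by (simp add: e field_simps)
  then have T: "T (N / e) = of_nat L * t" if "bar v + v = t" "t ^ (2 ^ m) = t" for t
    using T_fr_plus_self[OF that] by simp
  show "T (N / e) = 0" if "bar y = y" "bar y' = y'"
    using T[of 0] that D(1) m_pos by (simp add: v_def zero_power)
  show "T (N / e) = of_nat L" if yy: "bar y = y'"
  proof -
    have "bar y' = y"
      using yy bar_bar by blast
    then have "bar D = D"
      using yy D(1) by (simp add: add.commute)
    then have "bar v + v = (y' + y) / D"
      using yy by (simp add: v_def add_divide_distrib)
    also have "\<dots> = 1"
      using D by (simp add: add.commute)
    finally show ?thesis
      using T[of 1] by simp
  qed
qed

lemma trace_ratio_complement:
  assumes "e_coeff a b c d \<noteq> 0"
  shows "T ((b * bar b + c * bar c) / e_coeff a b c d) = of_nat K + T ((a * bar a + d * bar d) / e_coeff a b c d)"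
proof -
  have "b * bar b + c * bar c = e_coeff a b c d + (a * bar a + d * bar d)"
    by (simp add: e_coeff_def add_ac)
  then have "(b * bar b + c * bar c) / e_coeff a b c d = 1 + (a * bar a + d * bar d) / e_coeff a b c d"
    using assms by (simp add: add_divide_distrib)
  then show ?thesis
    by (simp only: T_add T_1)
qed

text \<open>Up to linear changes of source and target \<open>G\<close> is the power with exponent
  \<open>Q + 1\<close>. The trace in (5) is 0, so (5) says that \<open>K * L\<close> is even, which
  is the coprimality condition for this power.\<close>

lemma diagonal_good:
  assumes uv: "u * bar u \<noteq> v * bar v" and ad: "a' * bar a' \<noteq> d' * bar d'"
    and a: "a = a' * fr (bar u) * bar u + d' * fr v * v"
    and b: "b = a' * fr (bar u) * bar v + d' * fr v * u"
    and c: "c = a' * fr (bar v) * bar u + d' * fr u * v"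
    and d: "d = a' * fr (bar v) * bar v + d' * fr u * u"
  shows "e_coeff a b c d \<noteq> 0" "e_coeff a b c d * fr (s_coeff a b c d) = fr (e_coeff a b c d) * t_coeff a b c d"
    "proj_inj (G a b c d) \<longleftrightarrow> trace_cond a b c d"
proof -
  define D E where "D = u * bar u + v * bar v" and "E = a' * bar a' + d' * bar d'"
  note ids = diagonal_identities[OF a b c d D_def E_def]
  have nz: "D \<noteq> 0" "E \<noteq> 0"
    using uv ad by (simp_all add: D_def E_def)
  show e: "e_coeff a b c d \<noteq> 0"
    using nz by (simp add: ids)
  show "e_coeff a b c d * fr (s_coeff a b c d) = fr (e_coeff a b c d) * t_coeff a b c d"
    unfolding ids by (simp add: mult_ac)
  have "T ((b * bar b + c * bar c) / e_coeff a b c d) = 0"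
    by (rule trace_ratio(1)[OF nz(2) D_def nz(1) ids(4) ids(1)]) (simp_all add: mult.commute)
  then have tr: "trace_cond a b c d \<longleftrightarrow> even K \<or> even L"
    unfolding trace_cond_def by (simp add: of_nat_eq)
  have "G a b c d z = lin d' a' (lin u v z ^ (Q + 1))" for z
  proof -
    have "lin u v z ^ (Q + 1) = fr (lin u v z) * lin u v z"
      by (simp add: fr_eq power_add)
    then show ?thesis
      by (simp add: G_def B_def lin_def a b c d algebra_simps)
  qed
  then have "proj_inj (G a b c d) \<longleftrightarrow> proj_inj (\<lambda>z. lin d' a' (lin u v z ^ (Q + 1)))"
    by presburger
  also have "\<dots> \<longleftrightarrow> proj_inj (\<lambda>z. z ^ (Q + 1))"
    using proj_inj_comp_lin[OF uv, of "\<lambda>z. z ^ (Q + 1)"] ad by (subst proj_inj_lin_comp) auto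
  finally show "proj_inj (G a b c d) \<longleftrightarrow> trace_cond a b c d"
    unfolding tr proj_inj_power_iff coprime_iff_parity .
qed

text \<open>Now the power has exponent \<open>Q + q\<close>. The complementary trace is 0, so the
  trace in (5) is \<open>K\<close>; given \<open>parity\<close>, it equals \<open>K * L\<close>
  modulo 2 exactly for odd \<open>L\<close>.\<close>

lemma antidiagonal_good:
  assumes uv: "u * bar u \<noteq> v * bar v" and bc: "b' * bar b' \<noteq> c' * bar c'"
    and a: "a = b' * fr (bar u) * v + c' * fr v * bar u"
    and b: "b = b' * fr (bar u) * u + c' * fr v * bar v"
    and c: "c = b' * fr (bar v) * v + c' * fr u * bar u"
    and d: "d = b' * fr (bar v) * u + c' * fr u * bar v"
  shows "e_coeff a b c d \<noteq> 0" "e_coeff a b c d * fr (s_coeff a b c d) = fr (e_coeff a b c d) * t_coeff a b c d"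
    "proj_inj (G a b c d) \<longleftrightarrow> trace_cond a b c d"
proof -
  define D E where "D = u * bar u + v * bar v" and "E = b' * bar b' + c' * bar c'"
  note ids = antidiagonal_identities[OF a b c d D_def E_def]
  have nz: "D \<noteq> 0" "E \<noteq> 0"
    using uv bc by (simp_all add: D_def E_def)
  show e: "e_coeff a b c d \<noteq> 0"
    using nz by (simp add: ids)
  show "e_coeff a b c d * fr (s_coeff a b c d) = fr (e_coeff a b c d) * t_coeff a b c d"
    unfolding ids by (simp add: mult_ac)
  have "T ((a * bar a + d * bar d) / e_coeff a b c d) = 0"
    by (rule trace_ratio(1)[OF nz(2) D_def nz(1) ids(4) ids(1)]) (simp_all add: mult.commute)
  then have tr: "trace_cond a b c d \<longleftrightarrow> odd L"
    unfolding trace_cond_def trace_ratio_complement[OF e] using parity by (auto simp: of_nat_eq)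
  have "G a b c d z = lin c' b' (lin u v z ^ (Q + q))" for z
  proof -
    have "lin u v z ^ (Q + q) = fr (lin u v z) * bar (lin u v z)"
      by (simp add: fr_eq bar_eq power_add)
    then show ?thesis
      by (simp add: G_def B_def lin_def a b c d algebra_simps)
  qed
  then have "proj_inj (G a b c d) \<longleftrightarrow> proj_inj (\<lambda>z. lin c' b' (lin u v z ^ (Q + q)))"
    by presburger
  also have "\<dots> \<longleftrightarrow> proj_inj (\<lambda>z. z ^ (Q + q))"
    using proj_inj_comp_lin[OF uv, of "\<lambda>z. z ^ (Q + q)"] bc by (subst proj_inj_lin_comp) auto
  finally show "proj_inj (G a b c d) \<longleftrightarrow> trace_cond a b c d"
    unfolding tr proj_inj_power_iff coprime_iff_parity .
qed

lemma twisted_diagonal_good: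
  assumes "twisted_diagonal a b c d"
  shows "e_coeff a b c d \<noteq> 0" "e_coeff a b c d * fr (s_coeff a b c d) = fr (e_coeff a b c d) * t_coeff a b c d"
    "proj_inj (G a b c d) \<longleftrightarrow> trace_cond a b c d"
proof -
  obtain u v a' b' c' d' where uv: "u * bar u \<noteq> v * bar v"
    and B: "\<And>w z. B a b c d (lin (fr u) (fr v) w) (lin u v z) = B a' b' c' d' w z"
    and s: "a' * bar b' = c' * bar d'" and t: "a' * bar c' = b' * bar d'"
    and e: "a' * bar a' + b' * bar b' \<noteq> c' * bar c' + d' * bar d'"
    using assms unfolding twisted_diagonal_def by blast
  define D where "D = u * bar u - v * bar v"
  have D: "D \<noteq> 0"
    using uv by (simp add: D_def)
  have bD: "bar D = D"
    by (simp add: D_def mult.commute)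
  \<comment> \<open>The inverse substitution, which expresses the given coefficients through the
    normal form.\<close>
  define u' v' where "u' = bar u / D" and "v' = - v / D"
  have frD: "fr D = fr u * bar (fr u) - fr v * bar (fr v)" "fr D \<noteq> 0"
    using D by (simp add: D_def, simp only: fr_eq_0_iff not_False_eq_True)
  have inv: "lin u v (lin u' v' z) = z" "lin (fr u) (fr v) (lin (fr u') (fr v') z) = z" for z
    using lin_lin_inverse[OF D_def D, of z] lin_lin_inverse[OF frD, of z]
    by (simp_all add: u'_def v'_def)
  have uv': "u' * bar u' \<noteq> v' * bar v'"
  proof -
    have "u' * bar u' + v' * bar v' = D / (D * D)"
      by (simp add: u'_def v'_def bD add_divide_distrib[symmetric]) (simp add: D_def mult.commute)
    then show ?thesis
      using D by auto
  qed
  have "B a b c d w z = B a' b' c' d' (lin (fr u') (fr v') w) (lin u' v' z)" for w z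
    unfolding B[symmetric] inv ..
  note coeffs = B_eqD[OF this[unfolded B_lin]]
  \<comment> \<open>The product expands into four norms, which \<open>s\<close> and \<open>t\<close>
    make equal in pairs.\<close>
  have cross: "(a' * bar a' + d' * bar d') * (b' * bar b' + c' * bar c') = 0"
  proof -
    have "(a' * bar a' + d' * bar d') * (b' * bar b' + c' * bar c')
        = (a' * bar b') * bar (a' * bar b') + (a' * bar c') * bar (a' * bar c')
          + (b' * bar d') * bar (b' * bar d') + (c' * bar d') * bar (c' * bar d')"
      by (simp add: algebra_simps)
    also have "\<dots> = 0"
      unfolding s t by (simp add: add_ac)
    finally show ?thesis .
  qed
  have "(b' = 0 \<and> c' = 0 \<and> a' * bar a' \<noteq> d' * bar d') \<or> (a' = 0 \<and> d' = 0 \<and> b' * bar b' \<noteq> c' * bar c')"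
  proof (cases "a' * bar a' = d' * bar d'")
    case True
    then have ne: "b' * bar b' \<noteq> c' * bar c'"
      using e by (auto simp: add.commute)
    have "(a' * bar a') * (b' * bar b') = (a' * bar b') * bar (a' * bar b')"
      by (simp add: mult_ac)
    also have "\<dots> = (d' * bar d') * (c' * bar c')"
      unfolding s by (simp add: mult_ac)
    finally have "d' * bar d' * (b' * bar b' + c' * bar c') = 0"
      using True by (simp add: distrib_left)
    then have "d' = 0"
      using ne by simp
    then show ?thesis
      using True ne by simp
  next
    case False
    then have eq: "b' * bar b' = c' * bar c'"
      using cross by simp
    have "(a' * bar a') * (b' * bar b') = (a' * bar b') * bar (a' * bar b')"
      by (simp add: mult_ac)
    also have "\<dots> = (d' * bar d') * (c' * bar c')"
      unfolding s by (simp add: mult_ac)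
    finally have "(a' * bar a' + d' * bar d') * (c' * bar c') = 0"
      using eq by (simp add: distrib_right)
    then have "c' = 0"
      using False by simp
    then show ?thesis
      using eq False by simp
  qed
  then show "e_coeff a b c d \<noteq> 0" "e_coeff a b c d * fr (s_coeff a b c d) = fr (e_coeff a b c d) * t_coeff a b c d"
    "proj_inj (G a b c d) \<longleftrightarrow> trace_cond a b c d"
  proof (atomize(full), elim disjE conjE)
    assume "b' = 0" "c' = 0" and ne: "a' * bar a' \<noteq> d' * bar d'"
    then show "e_coeff a b c d \<noteq> 0 \<and> e_coeff a b c d * fr (s_coeff a b c d) = fr (e_coeff a b c d) * t_coeff a b c d \<and>
        (proj_inj (G a b c d) \<longleftrightarrow> trace_cond a b c d)"
      using diagonal_good[OF uv' ne, of a b c d] coeffs by simp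
  next
    assume "a' = 0" "d' = 0" and ne: "b' * bar b' \<noteq> c' * bar c'"
    then show "e_coeff a b c d \<noteq> 0 \<and> e_coeff a b c d * fr (s_coeff a b c d) = fr (e_coeff a b c d) * t_coeff a b c d \<and>
        (proj_inj (G a b c d) \<longleftrightarrow> trace_cond a b c d)"
      using antidiagonal_good[OF uv' ne, of a b c d] coeffs by simp
  qed
qed

lemma not_par_iff: "\<not> par z w \<longleftrightarrow> z * bar w + bar z * w \<noteq> 0"
  by (simp add: par_def)

text \<open>In this basis the product entering the trace is swapped with its conjugate, so the trace
  is \<open>L\<close>; given \<open>parity\<close>, it equals \<open>K * L\<close> modulo 2 exactly
  for odd \<open>K\<close>, the condition for the power with exponent \<open>Q + 1\<close> on the
  subfield units.\<close>

lemma rational_diagonal_good: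
  assumes "rational_diagonal a b c d"
  shows "e_coeff a b c d \<noteq> 0" "e_coeff a b c d * fr (s_coeff a b c d) = fr (e_coeff a b c d) * t_coeff a b c d"
    "proj_inj (G a b c d) \<longleftrightarrow> trace_cond a b c d"
proof -
  obtain z w where zw: "\<not> par z w" and mixed: "B a b c d (fr z) w = 0" "B a b c d (fr w) z = 0"
    and ng: "\<not> par (G a b c d z) (G a b c d w)"
    using assms unfolding rational_diagonal_def by blast
  define D where "D = z * bar w + bar z * w"
  define F where "F = fr D * D"
  have D: "D \<noteq> 0" "bar D = D"
    using zw unfolding D_def not_par_iff by (blast, simp add: add.commute)
  then have F: "F \<noteq> 0" "bar F = F"
    by (simp_all add: F_def)
  define g h where "g = G a b c d z / F" and "h = G a b c d w / F"
  define E where "E = g * bar h + bar g * h"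
  have "E * (F * F) = G a b c d z * bar (G a b c d w) + bar (G a b c d z) * G a b c d w"
    using F by (simp add: E_def g_def h_def field_simps)
  then have E: "E \<noteq> 0"
    using ng unfolding not_par_iff by auto
  note cb = coeffs_from_basis[where a = a and b = b and c = c and d = d and z = z and w = w, folded D_def F_def, unfolded mixed, folded G_def]
  have a: "a = g * fr w * w + h * fr z * z"
    using cb(1) F by (simp add: g_def h_def field_simps)
  have b: "b = g * fr w * bar w + h * fr z * bar z"
    using cb(2) F by (simp add: g_def h_def field_simps)
  have c: "c = g * fr (bar w) * w + h * fr (bar z) * z"
    using cb(3) F by (simp add: g_def h_def field_simps)
  have d: "d = g * fr (bar w) * bar w + h * fr (bar z) * bar z"
    using cb(4) F by (simp add: g_def h_def field_simps)
  note ids = rational_identities[OF a b c d D_def E_def]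
  show e: "e_coeff a b c d \<noteq> 0"
    using D E by (simp add: ids)
  show "e_coeff a b c d * fr (s_coeff a b c d) = fr (e_coeff a b c d) * t_coeff a b c d"
    unfolding ids by (simp add: mult_ac)
  have D': "D = w * bar z + bar w * z"
    by (simp add: D_def algebra_simps)
  have "T ((b * bar b + c * bar c) / e_coeff a b c d) = of_nat L"
    by (rule trace_ratio(2)[OF E D' D(1) ids(4) ids(1)]) simp
  then have tr: "trace_cond a b c d \<longleftrightarrow> odd K"
    unfolding trace_cond_def using parity by (auto simp: of_nat_eq)
  have "proj_inj (G a b c d) \<longleftrightarrow> coprime (Q + 1) (q - 1)"
    by (rule proj_inj_diagonal_iff[OF zw ng]) (simp add: G_combination mixed)
  then show "proj_inj (G a b c d) \<longleftrightarrow> trace_cond a b c d"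
    unfolding tr coprime_iff_parity .
qed

text \<open>The trace in (5) is \<open>K + L\<close>, which differs from \<open>K * L\<close> modulo
  2 unless both are even, so (5) fails together with injectivity.\<close>

lemma rational_antidiagonal_good:
  assumes zw: "\<not> par z w" and diag: "G a b c d z = 0" "G a b c d w = 0"
    and e: "e_coeff a b c d \<noteq> 0"
  shows "\<not> proj_inj (G a b c d)" "\<not> trace_cond a b c d"
proof -
  show "\<not> proj_inj (G a b c d)"
    using proj_inj_nonzero[of "G a b c d" z] diag not_par_imp_nonzero[OF zw] by blast
  define D where "D = z * bar w + bar z * w"
  define F where "F = fr D * D"
  have D: "D \<noteq> 0" "bar D = D"
    using zw unfolding D_def not_par_iff by (blast, simp add: add.commute)
  then have F: "F \<noteq> 0" "bar F = F"
    by (simp_all add: F_def)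
  define g h where "g = B a b c d (fr z) w / F" and "h = B a b c d (fr w) z / F"
  define E where "E = g * bar h + bar g * h"
  note cb = coeffs_from_basis[where a = a and b = b and c = c and d = d and z = z and w = w, folded D_def F_def G_def, unfolded diag]
  have a: "a = g * fr w * z + h * fr z * w"
    using cb(1) F by (simp add: g_def h_def field_simps)
  have b: "b = g * fr w * bar z + h * fr z * bar w"
    using cb(2) F by (simp add: g_def h_def field_simps)
  have c: "c = g * fr (bar w) * z + h * fr (bar z) * w"
    using cb(3) F by (simp add: g_def h_def field_simps)
  have d: "d = g * fr (bar w) * bar z + h * fr (bar z) * bar w"
    using cb(4) F by (simp add: g_def h_def field_simps)
  note ids = rational_mixed_identities[OF a b c d D_def E_def]
  have E: "E \<noteq> 0"
    using e ids(1) by auto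
  have D': "D = w * bar z + bar w * z"
    by (simp add: D_def algebra_simps)
  have "T ((a * bar a + d * bar d) / e_coeff a b c d) = of_nat L"
    by (rule trace_ratio(2)[OF E D' D(1) ids(2) ids(1)]) simp
  then show "\<not> trace_cond a b c d"
    unfolding trace_cond_def trace_ratio_complement[OF e] using parity by (auto simp: of_nat_eq)
qed

section \<open>From conditions (3) and (4) to a normal form\<close>

lemma twisted_identities:
  assumes "a' = a * fr (bar u) * bar u + b * fr (bar u) * v + c * fr v * bar u + d * fr v * v"
    and "b' = a * fr (bar u) * bar v + b * fr (bar u) * u + c * fr v * bar v + d * fr v * u"
    and "c' = a * fr (bar v) * bar u + b * fr (bar v) * v + c * fr u * bar u + d * fr u * v"
    and "d' = a * fr (bar v) * bar v + b * fr (bar v) * u + c * fr u * bar v + d * fr u * u"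
    and D: "D = u * bar u + v * bar v"
  shows "s_coeff a' b' c' d' = fr D * (s_coeff a b c d * (bar u * bar u) + e_coeff a b c d * (bar u * v) + bar (s_coeff a b c d) * (v * v))"
    and "t_coeff a' b' c' d' = D * (t_coeff a b c d * fr (bar u * bar u) + e_coeff a b c d * fr (bar u * v) + bar (t_coeff a b c d) * fr (v * v))"
    and "e_coeff a' b' c' d' = fr D * D * e_coeff a b c d"
  by (simp_all add: e_coeff_def s_coeff_def t_coeff_def assms(1-4) D algebra_simps)

text \<open>By \<open>twisted_identities\<close> the new coefficients \<open>s\<close> and
  \<open>t\<close> are, up to determinants, the two quadratic forms evaluated at
  \<open>bar u\<close>, \<open>v\<close> and their Frobenius images; a common root makes both vanish
  while \<open>e\<close> stays nonzero.\<close>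

lemma twisted_diagonalI:
  assumes uv: "u * bar u \<noteq> v * bar v"
    and "s_coeff a b c d * (bar u * bar u) + e_coeff a b c d * (bar u * v) + bar (s_coeff a b c d) * (v * v) = 0"
    and "t_coeff a b c d * fr (bar u * bar u) + e_coeff a b c d * fr (bar u * v) + bar (t_coeff a b c d) * fr (v * v) = 0"
    and "e_coeff a b c d \<noteq> 0"
  shows "twisted_diagonal a b c d"
proof -
  define D where "D = u * bar u + v * bar v"
  define a' where "a' = a * fr (bar u) * bar u + b * fr (bar u) * v + c * fr v * bar u + d * fr v * v"
  define b' where "b' = a * fr (bar u) * bar v + b * fr (bar u) * u + c * fr v * bar v + d * fr v * u"
  define c' where "c' = a * fr (bar v) * bar u + b * fr (bar v) * v + c * fr u * bar u + d * fr u * v"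
  define d' where "d' = a * fr (bar v) * bar v + b * fr (bar v) * u + c * fr u * bar v + d * fr u * u"
  note ids = twisted_identities[OF a'_def b'_def c'_def d'_def D_def]
  have "D \<noteq> 0"
    using uv by (simp add: D_def)
  then have "s_coeff a' b' c' d' = 0" "t_coeff a' b' c' d' = 0" "e_coeff a' b' c' d' \<noteq> 0"
    unfolding ids using assms by simp_all
  then have "a' * bar b' = c' * bar d'" "a' * bar c' = b' * bar d'"
    "a' * bar a' + b' * bar b' \<noteq> c' * bar c' + d' * bar d'"
    unfolding s_coeff_def t_coeff_def e_coeff_def by (simp, simp, metis add.assoc add_eq_0_iff)
  moreover have "B a b c d (lin (fr u) (fr v) w) (lin u v z) = B a' b' c' d' w z" for w z
    unfolding a'_def b'_def c'_def d'_def by (rule B_lin)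
  ultimately show ?thesis
    unfolding twisted_diagonal_def using uv by blast
qed

text \<open>By (4), Frobenius carries roots of the form with \<open>s\<close> to roots of the form
  with \<open>t\<close>; by (3) the two roots are distinct. If \<open>s = 0\<close> or a root lies
  off the unit circle, the twisted form results. Two roots on the circle are lines \<open>z\<close>,
  \<open>w\<close> by Hilbert 90, and the values of \<open>B\<close> on this basis have parallel
  rows and columns.\<close>

lemma classification:
  assumes e0: "e_coeff a b c d \<noteq> 0" and cond4: "e_coeff a b c d * fr (s_coeff a b c d) = fr (e_coeff a b c d) * t_coeff a b c d"
  shows "twisted_diagonal a b c d \<or> rational_diagonal a b c d \<or>
    (\<exists>z w. \<not> par z w \<and> G a b c d z = 0 \<and> G a b c d w = 0)"
proof -
  define s t e where "s = s_coeff a b c d" and "t = t_coeff a b c d" and "e = e_coeff a b c d"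
  have be: "bar e = e"
    by (simp add: e_def e_coeff_def mult.commute)
  have e: "e \<noteq> 0" and st: "e * fr s = fr e * t"
    using e0 cond4 by (simp_all add: s_def t_def e_def)
  have st': "e * fr (bar s) = fr e * bar t"
    using arg_cong[OF st, of bar] be by simp
  \<comment> \<open>After multiplication by \<open>fr e\<close>, the second quadratic at
    \<open>fr x\<close> becomes \<open>e\<close> times the Frobenius image of the first quadratic at
    \<open>x\<close>.\<close>
  have left_root: "t * fr (x * x) + e * fr x + bar t = 0" if "s * (x * x) + e * x + bar s = 0" for x
  proof -
    have "fr e * (t * fr (x * x) + e * fr x + bar t)
        = (fr e * t) * fr (x * x) + e * fr (e * x) + fr e * bar t"
      by (simp add: algebra_simps)
    also have "\<dots> = e * fr (s * (x * x) + e * x + bar s)"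
      unfolding st[symmetric] st'[symmetric] by (simp add: algebra_simps)
    finally show ?thesis
      unfolding that using e by simp
  qed
  show ?thesis
  proof (cases "s = 0")
    case True
    then have "t = 0"
      using st e by simp
    have "twisted_diagonal a b c d"
      using True \<open>t = 0\<close> e by (intro twisted_diagonalI[of 1 0]) (simp_all add: s_def t_def e_def)
    then show ?thesis
      by blast
  next
    case False
    have "bar (s * bar s) = s * bar s"
      by (simp add: mult.commute)
    from quadratic_has_root[OF be this] obtain y where y: "y * y + e * y + s * bar s = 0"
      by blast
    define x where "x = y / s"
    have "s * (s * (x * x) + e * x + bar s) = y * y + e * y + s * bar s"
      using False by (simp add: x_def field_simps)
    then have x: "s * (x * x) + e * x + bar s = 0"
      unfolding y using False by (simp only: mult_eq_0_iff) simp
    show ?thesis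
    proof (cases "x * bar x = 1")
      case False
      have "twisted_diagonal a b c d"
        using False x left_root[OF x] e
        by (intro twisted_diagonalI[of "bar x" 1]) (simp_all add: s_def t_def e_def mult.commute)
      then show ?thesis
        by blast
    next
      case norm_x: True
      \<comment> \<open>The other root, since the roots add up to \<open>e / s\<close>. Their
        product \<open>bar s / s\<close> has norm 1, so \<open>x'\<close> lies on the circle
        too.\<close>
      define x' where "x' = x + e / s"
      have "s * (x' * x) = s * (x * x) + e * x"
        using False by (simp add: x'_def field_simps)
      then have prod: "x' * x = bar s / s"
        using x False by (simp add: field_simps)
      have "(x' * bar x') * (x * bar x) = (x' * x) * bar (x' * x)"
        by (simp add: mult_ac)
      also have "\<dots> = 1"
        unfolding prod using False by simp
      finally have norm_x': "x' * bar x' = 1"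
        using norm_x by simp
      have "s * (x' * x') + e * x' + bar s = s * (x * x) + e * x + bar s"
        using False by (simp add: x'_def field_simps)
      then have x': "s * (x' * x') + e * x' + bar s = 0"
        using x by simp
      from norm_1_imp_quotient[OF norm_x] obtain z where z: "z \<noteq> 0" "bar z = x * z" .
      from norm_1_imp_quotient[OF norm_x'] obtain w where w: "w \<noteq> 0" "bar w = x' * w" .
      have zw: "z * bar w + bar z * w = z * w * (e / s)"
        unfolding z(2) w(2) by (simp add: x'_def algebra_simps)
      then have nzw: "\<not> par z w"
        unfolding not_par_iff using z w e False by simp
      have kernel_form: "kernel_form a b c d v = s * (bar v * bar v) + e * (v * bar v) + bar s * (v * v)" for v
        unfolding kernel_form_eq by (simp add: s_def e_def s_coeff_def e_coeff_def add_ac)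
      have right: "par (B a b c d v1 v) (B a b c d v2 v)"
        if "bar v = y * v" "s * (y * y) + e * y + bar s = 0" for v y v1 v2
      proof -
        have "kernel_form a b c d v = (s * (y * y) + e * y + bar s) * (v * v)"
          unfolding kernel_form that(1) by (simp add: algebra_simps)
        then have "kernel_form a b c d v = 0"
          unfolding that(2) by simp
        then show ?thesis
          unfolding B_eq_lin kernel_form_def by (intro par_lin) simp
      qed
      have left: "par (B a b c d (fr v) v1) (B a b c d (fr v) v2)"
        if v: "bar v = y * v" "s * (y * y) + e * y + bar s = 0" for v y v1 v2
      proof -
        let ?S = "d * fr v + b * bar (fr v)" and ?N = "c * fr v + a * bar (fr v)"
        have "?S * bar ?S + ?N * bar ?N = t * (bar (fr v) * bar (fr v)) + e * (fr v * bar (fr v)) + bar t * (fr v * fr v)"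
          by (simp add: t_def e_def t_coeff_def e_coeff_def algebra_simps)
        also have "\<dots> = (t * fr (y * y) + e * fr y + bar t) * (fr v * fr v)"
          unfolding bar_fr v(1) by (simp add: algebra_simps)
        also have "\<dots> = 0"
          unfolding left_root[OF v(2)] by simp
        finally have "?S * bar ?S = ?N * bar ?N"
          by (simp only: add_eq_0_iff)
        moreover have "B a b c d (fr v) v' = lin ?S ?N v'" for v'
          by (simp add: B_def lin_def algebra_simps)
        ultimately show ?thesis
          using par_lin by simp
      qed
      \<comment> \<open>As \<open>z + w\<close> is no zero of \<open>R\<close>, the map of the first
        argument that it defines is invertible; this supplies the non-parallel sums required by
        \<open>par_matrix_cases\<close>.\<close>
      have "kernel_form a b c d (z + w) = kernel_form a b c d z + kernel_form a b c d w + e * (z * bar w + bar z * w)"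
        unfolding kernel_form by (simp add: algebra_simps)
      also have "kernel_form a b c d z = (s * (x * x) + e * x + bar s) * (z * z)"
        unfolding kernel_form z(2) by (simp add: algebra_simps)
      also have "kernel_form a b c d w = (s * (x' * x') + e * x' + bar s) * (w * w)"
        unfolding kernel_form w(2) by (simp add: algebra_simps)
      finally have "kernel_form a b c d (z + w) = e * (z * w * (e / s))"
        unfolding x x' zw by simp
      then have "kernel_form a b c d (z + w) \<noteq> 0"
        using e z w False by simp
      then have "\<not> par (B a b c d (fr z) (z + w)) (B a b c d (fr w) (z + w))"
        unfolding kernel_form_def B_eq_lin using nzw by (subst par_lin_iff) (simp_all add: par_fr_iff)
      moreover have "B a b c d v (z + w) = B a b c d v z + B a b c d v w" for v
        by (simp add: B_def algebra_simps)
      ultimately have "\<not> par (B a b c d (fr z) z + B a b c d (fr z) w) (B a b c d (fr w) z + B a b c d (fr w) w)"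
        by simp
      from par_matrix_cases[OF right[OF z(2) x] right[OF w(2) x'] left[OF z(2) x] left[OF w(2) x'] this]
      show ?thesis
        unfolding rational_diagonal_def G_def using nzw by blast
    qed
  qed
qed

text \<open>For the first two outcomes of \<open>classification\<close> condition (5) decides
  injectivity; the third one contradicts (5).\<close>

lemma proj_inj_iff:
  "proj_inj (G a b c d) \<longleftrightarrow> e_coeff a b c d \<noteq> 0 \<and>
     e_coeff a b c d * fr (s_coeff a b c d) = fr (e_coeff a b c d) * t_coeff a b c d \<and> trace_cond a b c d"
proof
  assume P: "proj_inj (G a b c d)"
  then consider "rational_diagonal a b c d" | "twisted_diagonal a b c d"
    using proj_inj_imp_diagonal by blast
  then show "e_coeff a b c d \<noteq> 0 \<and>
     e_coeff a b c d * fr (s_coeff a b c d) = fr (e_coeff a b c d) * t_coeff a b c d \<and> trace_cond a b c d"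
  proof cases
    case 1
    then show ?thesis
      using P rational_diagonal_good[OF 1] by simp
  next
    case 2
    then show ?thesis
      using P twisted_diagonal_good[OF 2] by simp
  qed
next
  assume R: "e_coeff a b c d \<noteq> 0 \<and>
     e_coeff a b c d * fr (s_coeff a b c d) = fr (e_coeff a b c d) * t_coeff a b c d \<and> trace_cond a b c d"
  then consider "rational_diagonal a b c d" | "twisted_diagonal a b c d"
    | z w where "\<not> par z w" "G a b c d z = 0" "G a b c d w = 0"
    using classification by blast
  then show "proj_inj (G a b c d)"
  proof cases
    case 1
    then show ?thesis
      using R rational_diagonal_good(3)[OF 1] by blast
  next
    case 2
    then show ?thesis
      using R twisted_diagonal_good(3)[OF 2] by blast
  next
    case 3
    then show ?thesis
      using R rational_antidiagonal_good(2)[OF 3] by blast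
  qed
qed

end

section \<open>Translation to the parameters of the theorem\<close>

lemma two_part_of_gcd:
  fixes k l m :: nat
  assumes "k > 0" and m: "m = Max {n. (\<exists>i. n = 2 ^ i) \<and> n dvd gcd k l}"
  obtains K L where "k = m * K" "l = m * L" "odd K \<or> odd L"
proof -
  let ?A = "{n. (\<exists>i. n = 2 ^ i) \<and> n dvd gcd k l}"
  have "gcd k l > 0"
    using \<open>k > 0\<close> by simp
  then have "?A \<subseteq> {..gcd k l}"
    using dvd_imp_le by blast
  then have fin: "finite ?A"
    using finite_subset by blast
  have "2 ^ 0 \<in> ?A"
    by (intro CollectI conjI exI[of _ 0]) simp_all
  then have "m \<in> ?A"
    unfolding m using Max_in[OF fin] by blast
  then obtain i where i: "m = 2 ^ i" "m dvd gcd k l"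
    by blast
  then obtain K L where KL: "k = m * K" "l = m * L"
    by (metis dvdE dvd_trans gcd_dvd1 gcd_dvd2)
  have "odd K \<or> odd L"
  proof (rule ccontr)
    assume "\<not> ?thesis"
    then have "m * 2 dvd k" "m * 2 dvd l"
      unfolding KL by simp_all
    then have "2 ^ Suc i dvd gcd k l"
      by (simp add: i(1) mult.commute)
    then have "2 ^ Suc i \<in> ?A"
      by blast
    then have "2 ^ Suc i \<le> m"
      unfolding m using Max_ge[OF fin] by blast
    then show False
      using i(1) by simp
  qed
  with KL show ?thesis
    using that by blast
qed

lemma even_lcm_iff:
  fixes K L :: nat
  shows "even (lcm K L) \<longleftrightarrow> even K \<or> even L"
proof
  assume "even (lcm K L)"
  moreover have "lcm K L dvd K * L"
    by simp
  ultimately show "even K \<or> even L"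
    by (metis dvd_trans even_mult_iff)
next
  assume "even K \<or> even L"
  then show "even (lcm K L)"
    by (metis dvd_lcm1 dvd_lcm2 dvd_trans)
qed

theorem theorem1p1:
  fixes p k l q Q r m :: nat
    and a b c d e :: "'a::finite_field"
  assumes "prime p" and "k > 0" and "l > 0"
    and "q = p ^ k" and "Q = p ^ l"
    and "CARD('a) = q ^ 2"
    and "r > 0" and "[r = Q + 1] (mod (q + 1))"
    and "e = a ^ (q + 1) + b ^ (q + 1) + c ^ (q + 1) + d ^ (q + 1)"
    and "m = Max {n. (\<exists>i. n = 2 ^ i) \<and> n dvd gcd k l}"
  shows "permutation_poly (monom 1 r * pcompose (A_poly Q a b c d) (monom 1 (q - 1))) \<longleftrightarrow>
    gcd r (q - 1) = 1 \<and>
    p = 2 \<and>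
    e \<noteq> 0 \<and>
    (a * b ^ q + c * d ^ q) ^ Q = e ^ (Q - 1) * (a * c ^ q + b * d ^ q) \<and>
    trace_map (2 ^ m) (k div m) ((b ^ (q + 1) + c ^ (q + 1)) / e) = of_nat (lcm k l div m)"
proof -
  interpret frobenius_pair p k q "\<lambda>x::'a. x ^ q" l Q "\<lambda>x::'a. x ^ Q"
    using assms by unfold_locales simp_all
  note perm = permutation_poly_iff_proj_inj[OF assms(7,8), of a b c d]
  show ?thesis
  proof (cases "p = 2")
    \<comment> \<open>For odd \<open>p\<close> both sides are false: no such \<open>G\<close> is
      injective on lines.\<close>
    case False
    then show ?thesis
      unfolding perm using proj_inj_imp_diagonal by blast
  next
    case True
    obtain K L where KL: "k = m * K" "l = m * L" and parity: "odd K \<or> odd L"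
      using two_part_of_gcd[OF assms(2,10)] .
    interpret frobenius_pair_2 p k q "\<lambda>x::'a. x ^ q" l Q "\<lambda>x::'a. x ^ Q" m K L
      using True KL parity by unfold_locales
    have e: "e = e_coeff a b c d"
      by (simp add: assms(9) e_coeff_def power_add mult.commute)
    have "lcm k l div m = lcm K L"
      unfolding KL using m_pos by (simp add: lcm_mult_left)
    then have "(of_nat (lcm k l div m) :: 'a) = of_nat (K * L)"
      by (simp add: of_nat_eq even_lcm_iff)
    moreover have "k div m = K"
      using KL m_pos by simp
    moreover have "b ^ (q + 1) + c ^ (q + 1) = b * b ^ q + c * c ^ q"
      by (simp add: power_add mult.commute)
    ultimately have trace: "trace_cond a b c d \<longleftrightarrow>
        trace_map (2 ^ m) (k div m) ((b ^ (q + 1) + c ^ (q + 1)) / e) = of_nat (lcm k l div m)"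
      unfolding trace_cond_def e by simp
    \<comment> \<open>Condition (4) was carried along multiplied by \<open>e\<close>, which avoids
      the exponent \<open>Q - 1\<close>; cancelling needs \<open>e\<close> nonzero.\<close>
    have cond4: "e_coeff a b c d * s_coeff a b c d ^ Q = e_coeff a b c d ^ Q * t_coeff a b c d \<longleftrightarrow>
        (a * b ^ q + c * d ^ q) ^ Q = e ^ (Q - 1) * (a * c ^ q + b * d ^ q)" if "e \<noteq> 0"
    proof -
      have "e_coeff a b c d ^ Q = e * e ^ (Q - 1)"
        using Q_pos by (simp add: e power_eq_if)
      then show ?thesis
        using that by (simp add: e[symmetric] s_coeff_def t_coeff_def mult.assoc)
    qed
    show ?thesis
      unfolding perm proj_inj_iff trace using True cond4 e by auto
  qed
qed

end
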